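(* Let $d,k$ be positive integers. There exists $N=N(d,k)$ such that for every integer $n\ge N$, the value of Alpern's caching game with parameters $(n,d,k)$ is $$v_A(n,d,k)=\frac{k^d}{\binom{n+d-1}d}.$$
   Context: Alpern's caching game with parameters $(n,d,k)$: there are $n$ places. The hider digs holes at the places with nonnegative depths $h_1,\dots,h_n$ of total depth $\sum_i h_i\le 1$, and hides the $d$ treasures in these holes, each treasure at some place $i$ and some depth $t\in[0,h_i]$ (several treasures may be in the same hole). Afterwards the searcher digs adaptively: at each place she digs downward from the surface, and she may dig a total depth (summed over all places) of at most $k$; she finds a treasure at place $i$ and depth $t$ at the moment her digging at place $i$ reaches depth $t$, and she observes when she finds a treasure. She wins if she finds all $d$ treasures. Players may randomize; $v_A(n,d,k)$ is the probability the searcher wins under optimal play by both. *)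

theory Defs
  imports "HOL-Probability.Probability_Mass_Function" "HOL-Library.Multiset"
begin

(* A hider configuration: hole depths h (place \<Rightarrow> depth) and treasure positions
   tr (treasure index j < d \<Rightarrow> (place, depth)). *)
type_synonym hider_config = "(nat \<Rightarrow> real) \<times> (nat \<Rightarrow> nat \<times> real)"

(* A digging path: x s i = depth dug at place i once total depth s has been dug. *)
type_synonym dig_path = "real \<Rightarrow> nat \<Rightarrow> real"

(* Searcher pure strategy: maps the (hidden) configuration to a path; adaptivity is
   expressed by the non-anticipativity condition below. *)
type_synonym searcher_strategy = "hider_config \<Rightarrow> dig_path"

definition valid_config :: "nat \<Rightarrow> nat \<Rightarrow> hider_config \<Rightarrow> bool" where
  "valid_config n d C \<longleftrightarrow>
     (\<forall>i<n. 0 \<le> fst C i) \<and> (\<Sum>i<n. fst C i) \<le> 1 \<and>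
     (\<forall>j<d. fst (snd C j) < n \<and> 0 \<le> snd (snd C j) \<and> snd (snd C j) \<le> fst C (fst (snd C j)))"

definition valid_path :: "nat \<Rightarrow> nat \<Rightarrow> dig_path \<Rightarrow> bool" where
  "valid_path n k x \<longleftrightarrow>
     (\<forall>s\<in>{0..real k}. \<forall>i<n. 0 \<le> x s i) \<and>
     (\<forall>s\<in>{0..real k}. \<forall>s'\<in>{0..real k}. s \<le> s' \<longrightarrow> (\<forall>i<n. x s i \<le> x s' i)) \<and>
     (\<forall>s\<in>{0..real k}. (\<Sum>i<n. x s i) = s)"

definition found :: "dig_path \<Rightarrow> hider_config \<Rightarrow> real \<Rightarrow> nat \<Rightarrow> bool" where
  "found x C s j \<longleftrightarrow> snd (snd C j) \<le> x s (fst (snd C j))"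

definition observation :: "nat \<Rightarrow> dig_path \<Rightarrow> hider_config \<Rightarrow> real \<Rightarrow> (nat \<times> real) multiset" where
  "observation d x C s = image_mset (snd C) (filter_mset (found x C s) (mset_set {..<d}))"

definition searcher_strategies :: "nat \<Rightarrow> nat \<Rightarrow> nat \<Rightarrow> searcher_strategy set" where
  "searcher_strategies n d k = {\<sigma>.
     (\<forall>C. valid_config n d C \<longrightarrow> valid_path n k (\<sigma> C)) \<and>
     (\<forall>C C' s. valid_config n d C \<longrightarrow> valid_config n d C' \<longrightarrow> s \<in> {0..real k} \<longrightarrow>
        (\<forall>r\<in>{0..<s}. observation d (\<sigma> C) C r = observation d (\<sigma> C') C' r) \<longrightarrow>
        (\<forall>r\<in>{0..s}. \<sigma> C r = \<sigma> C' r))}"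

definition searcher_wins :: "nat \<Rightarrow> nat \<Rightarrow> searcher_strategy \<Rightarrow> hider_config \<Rightarrow> bool" where
  "searcher_wins d k \<sigma> C \<longleftrightarrow> (\<forall>j<d. found (\<sigma> C) C (real k) j)"

definition lower_value :: "nat \<Rightarrow> nat \<Rightarrow> nat \<Rightarrow> real" where
  "lower_value n d k = Sup {Inf {measure_pmf.prob p {\<sigma>. searcher_wins d k \<sigma> C} | C. valid_config n d C}
                           | p. set_pmf p \<subseteq> searcher_strategies n d k}"

definition upper_value :: "nat \<Rightarrow> nat \<Rightarrow> nat \<Rightarrow> real" where
  "upper_value n d k = Inf {Sup {measure_pmf.prob q {C. searcher_wins d k \<sigma> C} | \<sigma>. \<sigma> \<in> searcher_strategies n d k}
                           | q. set_pmf q \<subseteq> {C. valid_config n d C}}"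

end

theory Submission
  imports Defs "HOL-Library.Nat_Bijection" "HOL-Real_Asymp.Real_Asymp"
begin

text \<open>
  Upper bound. On a grid of mesh \<open>1/m\<close> the hider picks a uniformly random multiset of \<open>d\<close> places and
  uniformly random positive gaps between consecutive treasures, of total at most \<open>m\<close>. The searcher
  digs at most \<open>m k\<close> grid cells, and the ranks, in order of digging, of the \<open>d\<close> cells that contain
  treasures determine the whole search. So at most \<open>C(m k, d)\<close> of the \<open>C(n+d-1, d) C(m, d)\<close> configurations
  are won, and \<open>m\<close> tends to infinity.

  Lower bound. The searcher asks \<open>d\<close> queries, each a set of \<open>k\<close> places that are dug at equal speed until a
  treasure appears. She wins if each query meets the places of the remaining treasures in exactly one
  place, since then she spends at most \<open>k\<close> times the depth dug by the hider. Each query consists of places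
  never used before, except that the last answer may replace one of them. The
  probability of this replacement is chosen such that every multiset of places is found with the same
  probability.
\<close>

section \<open>Digging by parallel queries\<close>

text \<open>The strategy sets are infinite and no minimax theorem is invoked:
  \<open>lower_value\<close> and \<open>upper_value\<close> are each bounded on both sides. Both
  players get a finite family (plans, layouts) with a counting bound against every pure opponent,
  and that bound is averaged against an arbitrary mixed opponent. Origin of the replacement
  probability: let the treasures occupy j distinct places. Disjoint random blocks of size k catch
  these places at prescribed steps with probability k^j/(n(n-1)...(n-j+1)), and there are j! orders;
  both factors depend on j. With m treasures missing after r distinct answers, give a new answer the
  weight n-r and a repeated one the weight m+r. The weights n-r cancel the falling factorial. The
  sum m+r drops by one exactly at repeats, so their weights multiply to d!/j!, which cancels j!. A
  repeat gets no factor k from its block, hence replacement has probability k(m+r)/(n+m), which asks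
  for n large. Replacement removes the one needed place only with chance 1/k, so a new answer
  survives with probability exactly (n-r)/(n+m).\<close>

definition dig_parallel :: "nat set \<Rightarrow> (nat \<Rightarrow> real) \<Rightarrow> real \<Rightarrow> nat \<Rightarrow> real" where
  "dig_parallel Q y w i = y i + (if i \<in> Q then w else 0)"

definition candidates :: "nat set \<Rightarrow> (nat \<times> real) multiset \<Rightarrow> (nat \<times> real) set" where
  "candidates Q res = {c \<in> set_mset res. fst c \<in> Q}"

definition gap :: "(nat \<Rightarrow> real) \<Rightarrow> nat \<times> real \<Rightarrow> real" where
  "gap y c = snd c - y (fst c)"

definition next_gap :: "nat set \<Rightarrow> (nat \<Rightarrow> real) \<Rightarrow> (nat \<times> real) multiset \<Rightarrow> real" where
  "next_gap Q y res = Min (gap y ` candidates Q res)"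

definition next_place :: "nat set \<Rightarrow> (nat \<Rightarrow> real) \<Rightarrow> (nat \<times> real) multiset \<Rightarrow> nat" where
  "next_place Q y res = Min (fst ` {c \<in> candidates Q res. gap y c = next_gap Q y res})"

definition next_treasure :: "nat set \<Rightarrow> (nat \<Rightarrow> real) \<Rightarrow> (nat \<times> real) multiset \<Rightarrow> nat \<times> real" where
  "next_treasure Q y res = (next_place Q y res, y (next_place Q y res) + next_gap Q y res)"

text \<open>A stage digs the \<^term>\<open>k\<close> places of the current query at equal speed until a treasure is met in one of
  them; its place is the answer to the query. Ties are broken by the least place, so that the
  answer is a function of what has been observed. The list \<^term>\<open>hist\<close> of answers has the latest
  answer first, and \<^term>\<open>res\<close> holds the treasures that have not yet served as an answer.\<close>

primrec dig :: "nat \<Rightarrow> (nat list \<Rightarrow> nat set) list \<Rightarrow> nat list \<Rightarrow> (nat \<Rightarrow> real) \<Rightarrow> (nat \<times> real) multiset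
    \<Rightarrow> real \<Rightarrow> nat \<Rightarrow> real" where
  "dig k [] hist y res s = dig_parallel {..<k} y (s / real k)"
| "dig k (q # qs) hist y res s =
    (if candidates (q hist) res \<noteq> {} \<and> real k * next_gap (q hist) y res < s
     then dig k qs (next_place (q hist) y res # hist)
            (dig_parallel (q hist) y (next_gap (q hist) y res))
            (res - {#next_treasure (q hist) y res#})
            (s - real k * next_gap (q hist) y res)
     else dig_parallel (q hist) y (s / real k))"

text \<open>The inequality is not strict: several treasures may share a position, and one that lies
  exactly at the current bottom can still be waiting to serve as an answer. Its stage then has gap
  0.\<close>

definition unreached :: "(nat \<Rightarrow> real) \<Rightarrow> (nat \<times> real) multiset \<Rightarrow> bool" where
  "unreached y res \<longleftrightarrow> (\<forall>c\<in>#res. y (fst c) \<le> snd c)"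

lemma finite_candidates [simp]: "finite (candidates Q res)"
  unfolding candidates_def by simp

lemma next_gap_le: "c \<in> candidates Q res \<Longrightarrow> next_gap Q y res \<le> gap y c"
  unfolding next_gap_def by simp

lemma next_treasure_in:
  assumes "candidates Q res \<noteq> {}"
  shows "next_treasure Q y res \<in> candidates Q res" "gap y (next_treasure Q y res) = next_gap Q y res"
proof -
  let ?T = "{c \<in> candidates Q res. gap y c = next_gap Q y res}"
  have "next_gap Q y res \<in> gap y ` candidates Q res"
    unfolding next_gap_def using assms by (intro Min_in) auto
  then obtain c0 where "c0 \<in> candidates Q res" "gap y c0 = next_gap Q y res" by auto
  then have "?T \<noteq> {}" by blast
  then have "next_place Q y res \<in> fst ` ?T"
    unfolding next_place_def by (intro Min_in) auto
  then obtain c where c: "c \<in> ?T" "next_place Q y res = fst c" by blast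
  then have "c = next_treasure Q y res" unfolding next_treasure_def gap_def by (auto simp: prod_eq_iff)
  with c show "next_treasure Q y res \<in> candidates Q res"
    "gap y (next_treasure Q y res) = next_gap Q y res" by auto
qed

lemma next_treasure_mem:
  assumes "candidates Q res \<noteq> {}"
  shows "next_treasure Q y res \<in># res" "next_place Q y res \<in> Q"
  using next_treasure_in(1)[OF assms, of y] unfolding candidates_def next_treasure_def by auto

lemma next_gap_nonneg:
  assumes "candidates Q res \<noteq> {}" "unreached y res"
  shows "0 \<le> next_gap Q y res"
  using next_treasure_in[OF assms(1), of y] assms(2)
  unfolding unreached_def candidates_def gap_def by force

lemma unreached_step:
  assumes "unreached y res"
  shows "unreached (dig_parallel Q y (next_gap Q y res)) (res - {#next_treasure Q y res#})"
  unfolding unreached_def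
proof
  fix c assume "c \<in># res - {#next_treasure Q y res#}"
  then have c: "c \<in># res" by (rule in_diffD)
  show "dig_parallel Q y (next_gap Q y res) (fst c) \<le> snd c"
  proof (cases "fst c \<in> Q")
    case True
    then have "c \<in> candidates Q res" using c unfolding candidates_def by auto
    from next_gap_le[OF this, of y] show ?thesis using True unfolding dig_parallel_def gap_def by simp
  next
    case False
    then show ?thesis using c assms unfolding unreached_def dig_parallel_def by auto
  qed
qed

lemma dig_0:
  assumes "unreached y res"
  shows "dig k qs hist y res 0 = y"
proof (cases qs)
  case Nil
  then show ?thesis by (auto simp: dig_parallel_def fun_eq_iff)
next
  case (Cons q qs')
  have "\<not> real k * next_gap (q hist) y res < 0" if "candidates (q hist) res \<noteq> {}"
    using next_gap_nonneg[OF that assms] by (simp add: not_less)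
  then show ?thesis using Cons by (auto simp: dig_parallel_def fun_eq_iff)
qed

text \<open>At the moment of the switch both branches of \<open>dig\<close> describe the same
  depths, so the strict inequality in the definition may be relaxed here.\<close>

lemma dig_Cons_late:
  assumes "unreached y res" "candidates (q hist) res \<noteq> {}" "0 < k" "real k * next_gap (q hist) y res \<le> s"
  shows "dig k (q # qs) hist y res s = dig k qs (next_place (q hist) y res # hist)
            (dig_parallel (q hist) y (next_gap (q hist) y res))
            (res - {#next_treasure (q hist) y res#})
            (s - real k * next_gap (q hist) y res)"
proof (cases "real k * next_gap (q hist) y res = s")
  case True
  have "next_gap (q hist) y res = s / real k" using True assms(3) by (simp add: field_simps)
  then show ?thesis using True dig_0[OF unreached_step[OF assms(1)], of k qs _ "q hist"] by simp
next
  case False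
  then show ?thesis using assms by simp
qed

lemma sum_dig_parallel:
  assumes "Q \<subseteq> {..<n}" "card Q = k"
  shows "(\<Sum>i<n. dig_parallel Q y w i) = (\<Sum>i<n. y i) + real k * w"
proof -
  have "(\<Sum>i<n. if i \<in> Q then w else 0) = (\<Sum>i\<in>{..<n} \<inter> Q. w)"
    by (intro sum.inter_restrict[symmetric]) simp
  also have "\<dots> = real k * w" using assms by (simp add: Int_absorb1)
  finally show ?thesis unfolding dig_parallel_def by (simp add: sum.distrib)
qed

definition queries_of_size :: "nat \<Rightarrow> nat \<Rightarrow> (nat list \<Rightarrow> nat set) set" where
  "queries_of_size n k = {q. \<forall>hist. q hist \<subseteq> {..<n} \<and> card (q hist) = k}"

text \<open>A valid path has spent exactly \<open>s\<close> at time \<open>s\<close>. This is why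
  digging goes on in \<open>{..<k}\<close> once the queries are used up, and why a query that meets
  nothing is dug until the budget ends.\<close>

lemma sum_dig:
  assumes "set qs \<subseteq> queries_of_size n k" "0 < k" "k \<le> n"
  shows "(\<Sum>i<n. dig k qs hist y res s i) = (\<Sum>i<n. y i) + s"
  using assms(1)
proof (induction qs arbitrary: hist y res s)
  case Nil
  then show ?case using sum_dig_parallel[of "{..<k}" n k y] assms by simp
next
  case (Cons q qs)
  then have q: "q hist \<subseteq> {..<n}" "card (q hist) = k" unfolding queries_of_size_def by auto
  have "set qs \<subseteq> queries_of_size n k" using Cons.prems by simp
  note IH = Cons.IH[OF this]
  show ?case
    using sum_dig_parallel[OF q, of y] IH assms(2) by simp
qed

lemma dig_mono:
  assumes "unreached y res" "0 < k" "0 \<le> s" "s \<le> s'"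
  shows "dig k qs hist y res s i \<le> dig k qs hist y res s' i"
  using assms(1,3,4)
proof (induction qs arbitrary: hist y res s s')
  case Nil
  then show ?case using assms(2) by (simp add: dig_parallel_def divide_right_mono)
next
  case (Cons q qs)
  let ?w = "next_gap (q hist) y res"
  note IH = Cons.IH[OF unreached_step[OF Cons.prems(1)]]
  show ?case
  proof (cases "candidates (q hist) res \<noteq> {} \<and> real k * ?w < s'")
    case False
    then show ?thesis using assms(2) Cons.prems by (auto simp: dig_parallel_def divide_right_mono)
  next
    case late: True
    show ?thesis
    proof (cases "real k * ?w < s")
      case True
      then show ?thesis using late Cons.prems IH by simp
    next
      case False
      then have "s / real k \<le> ?w" using assms(2) by (simp add: field_simps)
      then have "dig k (q # qs) hist y res s i \<le> dig_parallel (q hist) y ?w i"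
        using False by (simp add: dig_parallel_def)
      also have "\<dots> = dig k qs (next_place (q hist) y res # hist) (dig_parallel (q hist) y ?w)
          (res - {#next_treasure (q hist) y res#}) 0 i"
        by (simp add: dig_0[OF unreached_step[OF Cons.prems(1)]])
      also have "\<dots> \<le> dig k (q # qs) hist y res s' i"
        using late IH[of 0 "s' - real k * ?w"] by simp
      finally show ?thesis .
    qed
  qed
qed

lemma dig_ge:
  assumes "unreached y res" "0 < k" "0 \<le> s"
  shows "y i \<le> dig k qs hist y res s i"
  using dig_mono[OF assms(1,2) order_refl assms(3), of qs hist i] dig_0[OF assms(1)] by simp

section \<open>Non-anticipation of the dig\<close>

definition reached :: "(nat \<Rightarrow> real) \<Rightarrow> (nat \<times> real) multiset \<Rightarrow> (nat \<times> real) multiset" where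
  "reached x res = filter_mset (\<lambda>c. snd c \<le> x (fst c)) res"

lemma dig_early:
  assumes "candidates (q hist) res \<noteq> {} \<Longrightarrow> s \<le> real k * next_gap (q hist) y res"
  shows "dig k (q # qs) hist y res s = dig_parallel (q hist) y (s / real k)"
proof -
  have "\<not> (candidates (q hist) res \<noteq> {} \<and> real k * next_gap (q hist) y res < s)"
    using assms by (meson not_less)
  then show ?thesis by (simp only: dig.simps if_False)
qed

text \<open>If the first stage for \<^term>\<open>res\<close> ends no later than for \<^term>\<open>res'\<close>, then up to that moment both digs agree, and the
  treasures that end the stage belong to the common observation.\<close>

lemma next_treasure_cong:
  assumes "0 < k" and cand: "candidates (q hist) res \<noteq> {}"
    and first: "candidates (q hist) res' \<noteq> {} \<Longrightarrow> next_gap (q hist) y res \<le> next_gap (q hist) y res'"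
    and obs: "reached (dig k (q # qs) hist y res (real k * next_gap (q hist) y res)) res =
      reached (dig k (q # qs) hist y res' (real k * next_gap (q hist) y res)) res'"
  shows "candidates (q hist) res' \<noteq> {}" "next_gap (q hist) y res' = next_gap (q hist) y res"
    "next_place (q hist) y res' = next_place (q hist) y res"
proof -
  let ?Q = "q hist" and ?w = "next_gap (q hist) y res"
  have 1: "dig k (q # qs) hist y res (real k * ?w) = dig_parallel ?Q y ?w"
    using assms(1) by simp
  have 2: "dig k (q # qs) hist y res' (real k * ?w) = dig_parallel ?Q y ?w"
    using assms(1) first by (subst dig_early) auto
  have obs': "reached (dig_parallel ?Q y ?w) res = reached (dig_parallel ?Q y ?w) res'"
    using obs unfolding 1 2 .
  have reached_in: "c \<in># reached (dig_parallel ?Q y ?w) r \<longleftrightarrow> c \<in> candidates ?Q r \<and> gap y c \<le> ?w"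
    if "fst c \<in> ?Q" for c r
    using that unfolding reached_def dig_parallel_def candidates_def gap_def by auto
  have same: "c \<in> candidates ?Q res \<and> gap y c \<le> ?w \<longleftrightarrow> c \<in> candidates ?Q res' \<and> gap y c \<le> ?w" for c
  proof (cases "fst c \<in> ?Q")
    case True
    then show ?thesis using reached_in[OF True, of res] reached_in[OF True, of res'] obs' by simp
  next
    case False
    then show ?thesis unfolding candidates_def by auto
  qed
  have nt: "next_treasure ?Q y res \<in> candidates ?Q res'"
    using same[of "next_treasure ?Q y res"] next_treasure_in[OF cand, of y] by auto
  then show ne: "candidates ?Q res' \<noteq> {}" by auto
  have "next_gap ?Q y res' \<le> ?w"
    using next_gap_le[OF nt, of y] next_treasure_in(2)[OF cand, of y] by simp
  with first[OF ne] show w: "next_gap ?Q y res' = ?w" by simp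
  have "{c \<in> candidates ?Q res. gap y c = ?w} = {c \<in> candidates ?Q res'. gap y c = ?w}"
    using same by fastforce
  then show "next_place ?Q y res' = next_place ?Q y res"
    unfolding next_place_def w by simp
qed

lemma reached_remove:
  assumes "c \<in># res" "snd c \<le> x (fst c)"
  shows "reached x (res - {#c#}) = reached x res - {#c#}"
  using assms unfolding reached_def by (simp add: filter_diff_mset)

text \<open>Induction on the queries: the two digs leave the current stage at the same time with the
  same answer, or neither leaves it before time \<open>s\<close>. After a common stage the answered
  treasure is removed from both sides and the induction hypothesis applies.\<close>

lemma dig_nonanticipating:
  assumes "unreached y res" "unreached y res'" "0 < k" "0 \<le> s"
    and "\<And>r. 0 \<le> r \<Longrightarrow> r < s \<Longrightarrow>
      reached (dig k qs hist y res r) res = reached (dig k qs hist y res' r) res'"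
    and "0 \<le> r" "r \<le> s"
  shows "dig k qs hist y res r = dig k qs hist y res' r"
  using assms(1,2,4-)
proof (induction qs arbitrary: hist y res res' s r)
  case Nil
  then show ?case by simp
next
  case (Cons q qs)
  let ?Q = "q hist"
  let ?w = "next_gap ?Q y res" and ?w' = "next_gap ?Q y res'"
  let ?c = "next_treasure ?Q y res"
  have k0: "(0::real) < real k" using assms(3) by simp
  show ?case
  proof (cases "candidates ?Q res \<noteq> {} \<and> real k * ?w < s \<or> candidates ?Q res' \<noteq> {} \<and> real k * ?w' < s")
    case False
    \<comment> \<open>Neither stage ends strictly before \<open>s\<close>. A treasure met exactly at
      time \<open>s\<close> does not yet alter the path, which matches observations that are known
      to agree only on times below \<open>s\<close>.\<close>
    then show ?thesis using Cons.prems(6) by (auto simp: not_less)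
  next
    case True
    \<comment> \<open>Take the stage that ends no later than the other. Its end lies before
      \<open>s\<close>, where the observations agree, so the other dig meets the same treasures at
      that time; the two cases are symmetric.\<close>
    have same: "candidates ?Q res \<noteq> {} \<and> candidates ?Q res' \<noteq> {} \<and> ?w' = ?w \<and>
        next_place ?Q y res' = next_place ?Q y res \<and> real k * ?w < s"
    proof (cases "candidates ?Q res \<noteq> {} \<and> (candidates ?Q res' \<noteq> {} \<longrightarrow> ?w \<le> ?w')")
      case c: True
      then have lt: "real k * ?w < s" using True
        by (smt (verit, best) k0 mult_le_cancel_left_pos)
      have "0 \<le> real k * ?w" using next_gap_nonneg[of ?Q res y] c Cons.prems(1) by auto
      note obs = Cons.prems(4)[OF this lt]
      show ?thesis using next_treasure_cong[OF assms(3) _ _ obs] c lt by auto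
    next
      case False
      then have c: "candidates ?Q res' \<noteq> {}" "candidates ?Q res \<noteq> {} \<Longrightarrow> ?w' \<le> ?w" using True by auto
      then have lt: "real k * ?w' < s" using True
        by (smt (verit, best) k0 mult_le_cancel_left_pos)
      have "0 \<le> real k * ?w'" using next_gap_nonneg[of ?Q res' y] c Cons.prems(2) by auto
      note obs = Cons.prems(4)[OF this lt, symmetric]
      show ?thesis using next_treasure_cong[OF assms(3) c obs] c lt by auto
    qed
    then have ne: "candidates ?Q res \<noteq> {}" "candidates ?Q res' \<noteq> {}" and w: "?w' = ?w"
      and pl: "next_place ?Q y res' = next_place ?Q y res" and lt: "real k * ?w < s" by auto
    have c': "next_treasure ?Q y res' = ?c" unfolding next_treasure_def w pl ..
    let ?y = "dig_parallel ?Q y ?w" and ?h = "next_place ?Q y res # hist"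
    have u: "unreached ?y (res - {#?c#})" "unreached ?y (res' - {#?c#})"
      using unreached_step[OF Cons.prems(1), of ?Q] unreached_step[OF Cons.prems(2), of ?Q] unfolding w c' .
    have late: "dig k (q # qs) hist y res (real k * ?w + t) = dig k qs ?h ?y (res - {#?c#}) t"
       "dig k (q # qs) hist y res' (real k * ?w + t) = dig k qs ?h ?y (res' - {#?c#}) t" if "0 \<le> t" for t
      using dig_Cons_late[where q = q and hist = hist and s = "real k * ?w + t" and qs = qs, OF Cons.prems(1) ne(1) assms(3)]
        dig_Cons_late[where q = q and hist = hist and s = "real k * ?w + t" and qs = qs, OF Cons.prems(2) ne(2) assms(3)] that unfolding w pl c' by auto
    have cy: "snd ?c \<le> ?y (fst ?c)"
      using next_treasure_mem(2)[OF ne(1), of y] unfolding next_treasure_def dig_parallel_def by simp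
    have cx: "snd ?c \<le> dig k qs ?h ?y (res - {#?c#}) t (fst ?c)"
      "snd ?c \<le> dig k qs ?h ?y (res' - {#?c#}) t (fst ?c)" if "0 \<le> t" for t
      using cy dig_ge[OF u(1) assms(3) that] dig_ge[OF u(2) assms(3) that] order_trans by blast+
    have cin: "?c \<in># res" "?c \<in># res'"
      using next_treasure_mem(1)[OF ne(1), of y] next_treasure_mem(1)[OF ne(2), of y] c' by auto
    \<comment> \<open>From the end of the stage on, the answered treasure is reached in both digs,
      so removing it from both observations preserves their equality.\<close>
    have obs: "reached (dig k qs ?h ?y (res - {#?c#}) t) (res - {#?c#}) =
        reached (dig k qs ?h ?y (res' - {#?c#}) t) (res' - {#?c#})" if t: "0 \<le> t" "t < s - real k * ?w" for t
    proof -
      have "0 \<le> real k * ?w + t" using next_gap_nonneg[OF ne(1) Cons.prems(1)] t by simp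
      from Cons.prems(4)[OF this] t
      have "reached (dig k qs ?h ?y (res - {#?c#}) t) res = reached (dig k qs ?h ?y (res' - {#?c#}) t) res'"
        using late[OF t(1)] by simp
      then show ?thesis
        using reached_remove[where x="dig k qs ?h ?y (res - {#?c#}) t", OF cin(1) cx(1)[OF t(1)]]
          reached_remove[where x="dig k qs ?h ?y (res' - {#?c#}) t", OF cin(2) cx(2)[OF t(1)]] by simp
    qed
    show ?thesis
    proof (cases "real k * ?w < r")
      case r: True
      have "dig k qs ?h ?y (res - {#?c#}) (r - real k * ?w) = dig k qs ?h ?y (res' - {#?c#}) (r - real k * ?w)"
        using Cons.IH[OF u, of "s - real k * ?w"] obs lt r Cons.prems(6) by simp
      then show ?thesis using late[of "r - real k * ?w"] r by simp
    next
      case False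
      then show ?thesis using w by simp
    qed
  qed
qed

definition dig_strategy :: "nat \<Rightarrow> nat \<Rightarrow> (nat list \<Rightarrow> nat set) list \<Rightarrow> searcher_strategy" where
  "dig_strategy d k qs C = dig k qs [] (\<lambda>_. 0) (image_mset (snd C) (mset_set {..<d}))"

lemma observation_eq_reached:
  "observation d x C s = reached (x s) (image_mset (snd C) (mset_set {..<d}))"
  unfolding observation_def reached_def filter_mset_image_mset found_def by (simp add: comp_def)

lemma unreached_valid_config:
  assumes "valid_config n d C"
  shows "unreached (\<lambda>_. 0) (image_mset (snd C) (mset_set {..<d}))"
  using assms unfolding unreached_def valid_config_def by auto

lemma dig_strategy_in_searcher_strategies:
  assumes "set qs \<subseteq> queries_of_size n k" "0 < k" "k \<le> n"
  shows "dig_strategy d k qs \<in> searcher_strategies n d k"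
  unfolding searcher_strategies_def
proof (intro CollectI conjI allI impI ballI)
  fix C assume "valid_config n d C"
  note u = unreached_valid_config[OF this]
  show "valid_path n k (dig_strategy d k qs C)"
    unfolding valid_path_def dig_strategy_def
    using dig_ge[OF u assms(2)] dig_mono[OF u assms(2)] sum_dig[OF assms] by auto
next
  fix C C' s r
  assume "valid_config n d C" "valid_config n d C'" and s: "s \<in> {0..real k}"
    and obs: "\<forall>r\<in>{0..<s}. observation d (dig_strategy d k qs C) C r = observation d (dig_strategy d k qs C') C' r"
    and r: "r \<in> {0..s}"
  note u = this(1,2)[THEN unreached_valid_config]
  show "dig_strategy d k qs C r = dig_strategy d k qs C' r"
    unfolding dig_strategy_def
    by (rule dig_nonanticipating[OF u assms(2), of s])
       (use s obs r in \<open>auto simp: observation_eq_reached dig_strategy_def\<close>)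
qed

section \<open>Multisets of places on which a list of queries succeeds\<close>

text \<open>Depths disappear from the problem here: when a query meets the remaining treasures in a
  single place, the answer is that place whatever depths the hider chose. What remains is a count
  over multisets of places.\<close>

primrec forced :: "(nat list \<Rightarrow> nat set) list \<Rightarrow> nat list \<Rightarrow> nat multiset \<Rightarrow> bool" where
  "forced [] hist M \<longleftrightarrow> M = {#}"
| "forced (q # qs) hist M \<longleftrightarrow> (\<exists>a. q hist \<inter> set_mset M = {a} \<and> forced qs (a # hist) (M - {#a#}))"

text \<open>Each stage costs \<^term>\<open>k\<close> times the depth gained at the answered place, which was dug by the
  hider too; hence the hider's total depth bounds the total cost.\<close>

lemma forced_dig_finds_all:
  assumes "unreached y res" "0 < k" "forced qs hist (image_mset fst res)"
    and "\<And>c. c \<in># res \<Longrightarrow> fst c < n \<and> snd c \<le> h (fst c)"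
    and "real k * (\<Sum>i<n. max 0 (h i - y i)) \<le> s"
    and "c \<in># res"
  shows "snd c \<le> dig k qs hist y res s (fst c)"
  using assms(1,3-)
proof (induction qs arbitrary: hist y res s)
  case Nil
  then show ?case by simp
next
  case (Cons q qs)
  let ?Q = "q hist" and ?w = "next_gap (q hist) y res" and ?c = "next_treasure (q hist) y res"
  let ?a = "next_place (q hist) y res"
  let ?y = "dig_parallel ?Q y ?w"
  obtain a where a: "?Q \<inter> fst ` set_mset res = {a}" "forced qs (a # hist) (image_mset fst res - {#a#})"
    using Cons.prems(2) by auto
  have "a \<in> ?Q \<inter> fst ` set_mset res" using a(1) by simp
  then have ne: "candidates ?Q res \<noteq> {}" unfolding candidates_def by blast
  note c_in = next_treasure_mem[OF ne, of y]
  have aa: "?a = a" using a(1) c_in unfolding next_treasure_def by force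
  have w0: "0 \<le> ?w" using next_gap_nonneg[OF ne Cons.prems(1)] .
  have an: "?a < n" "y ?a + ?w \<le> h ?a"
    using Cons.prems(3)[OF c_in(1)] unfolding next_treasure_def by auto
  have "(\<Sum>i<n. max 0 (h i - ?y i)) \<le> (\<Sum>i<n. max 0 (h i - y i) - (if i = ?a then ?w else 0))"
  proof (rule sum_mono)
    fix i
    show "max 0 (h i - ?y i) \<le> max 0 (h i - y i) - (if i = ?a then ?w else 0)"
      using w0 an(2) c_in(2) unfolding dig_parallel_def by auto
  qed
  also have "\<dots> = (\<Sum>i<n. max 0 (h i - y i)) - ?w"
    using an(1) by (simp add: sum_subtractf)
  finally have pot: "(\<Sum>i<n. max 0 (h i - ?y i)) \<le> (\<Sum>i<n. max 0 (h i - y i)) - ?w" .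
  moreover have "0 \<le> (\<Sum>i<n. max 0 (h i - ?y i))" by (intro sum_nonneg) auto
  ultimately have "real k * ?w \<le> real k * (\<Sum>i<n. max 0 (h i - y i))"
    by (intro mult_left_mono) auto
  then have le: "real k * ?w \<le> s" using Cons.prems(4) by simp
  have s': "real k * (\<Sum>i<n. max 0 (h i - ?y i)) \<le> s - real k * ?w"
    using mult_left_mono[OF pot, of "real k"] Cons.prems(4) by (simp add: algebra_simps)
  have u: "unreached ?y (res - {#?c#})" using unreached_step[OF Cons.prems(1)] .
  have eq: "dig k (q # qs) hist y res s = dig k qs (?a # hist) ?y (res - {#?c#}) (s - real k * ?w)"
    using dig_Cons_late[where q = q and hist = hist, OF Cons.prems(1) ne assms(2) le] .
  show ?case
  proof (cases "c = ?c")
    case True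
    have "snd ?c = ?y (fst ?c)"
      using c_in(2) unfolding next_treasure_def dig_parallel_def by simp
    also have "\<dots> \<le> dig k (q # qs) hist y res s (fst ?c)"
      unfolding eq using dig_ge[OF u assms(2)] le by simp
    finally show ?thesis using True by simp
  next
    case False
    have img: "image_mset fst (res - {#?c#}) = image_mset fst res - {#a#}"
      using c_in(1) aa by (simp add: image_mset_Diff next_treasure_def)
    show ?thesis unfolding eq
    proof (rule Cons.IH[OF u _ _ s'])
      show "forced qs (?a # hist) (image_mset fst (res - {#?c#}))" using a(2) unfolding img aa .
      show "c' \<in># res - {#?c#} \<Longrightarrow> fst c' < n \<and> snd c' \<le> h (fst c')" for c'
        using Cons.prems(3) in_diffD by metis
      show "c \<in># res - {#?c#}" using Cons.prems(5) False by (simp add: in_diff_count)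
    qed
  qed
qed

lemma forced_imp_searcher_wins:
  assumes "valid_config n d C" "0 < k"
    and "forced qs [] (image_mset (fst \<circ> snd C) (mset_set {..<d}))"
  shows "searcher_wins d k (dig_strategy d k qs) C"
  unfolding searcher_wins_def found_def dig_strategy_def
proof (intro allI impI)
  fix j assume j: "j < d"
  let ?res = "image_mset (snd C) (mset_set {..<d})"
  have h: "(\<Sum>i<n. max 0 (fst C i - 0)) \<le> 1"
  proof -
    have "(\<Sum>i<n. max 0 (fst C i - 0)) = (\<Sum>i<n. fst C i)"
      using assms(1) unfolding valid_config_def by (intro sum.cong) auto
    then show ?thesis using assms(1) unfolding valid_config_def by simp
  qed
  show "snd (snd C j) \<le> dig k qs [] (\<lambda>_. 0) ?res (real k) (fst (snd C j))"
  proof (rule forced_dig_finds_all[OF unreached_valid_config[OF assms(1)] assms(2), where h = "fst C" and n = n])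
    show "forced qs [] (image_mset fst ?res)" using assms(3) by (simp add: image_mset.compositionality comp_def)
    show "real k * (\<Sum>i<n. max 0 (fst C i - 0)) \<le> real k" using h mult_left_le by (simp add: mult_left_le)
  qed (use assms(1) j in \<open>auto simp: valid_config_def\<close>)
qed

section \<open>Random plans of queries\<close>

definition plan_steps :: "nat \<Rightarrow> nat \<Rightarrow> nat set \<Rightarrow> (nat set \<times> nat \<times> nat) set" where
  "plan_steps k U F = (SIGMA B:{B. B \<subseteq> F \<and> card B = k}. B \<times> {..<U})"

text \<open>The whole block is removed from \<open>F\<close>, including the place that a replacement
  would drop, so later blocks are disjoint from it. The number of continuations depends only on the
  size of \<open>F\<close>, hence a uniform plan makes uniform independent choices of
  \<open>x\<close> and \<open>u\<close> at every step.\<close>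

primrec plans :: "nat \<Rightarrow> nat \<Rightarrow> nat \<Rightarrow> nat set \<Rightarrow> (nat set \<times> nat \<times> nat) list set" where
  "plans n k 0 F = {[]}"
| "plans n k (Suc m) F =
    (\<lambda>(s, p). s # p) ` (SIGMA s:plan_steps k (n + Suc m) F. plans n k m (F - fst s))"

text \<open>In a step \<^term>\<open>(B, x, u)\<close> the number \<^term>\<open>u\<close> is uniform below \<^term>\<open>n + m\<close>, where \<^term>\<open>m\<close> treasures are
  missing, and decides whether the last answer replaces \<^term>\<open>x\<close> in the query. With this threshold,
  after \<^term>\<open>r\<close> distinct answers the weight of a repeated answer is proportional to \<^term>\<open>m + r\<close> and that of a new one to
  \<^term>\<open>n - r\<close>; the product of these weights is the same for all multisets of places.\<close>

fun plan_query :: "nat \<Rightarrow> nat \<Rightarrow> nat set \<times> nat \<times> nat \<Rightarrow> nat list \<Rightarrow> nat set" where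
  "plan_query k m (B, x, u) hist =
    (if hist \<noteq> [] \<and> u < k * (m + card (set hist)) then insert (hd hist) (B - {x}) else B)"

text \<open>The fallback only concerns answer lists that do not arise in a successful search.\<close>

definition safe_query :: "nat \<Rightarrow> nat \<Rightarrow> (nat list \<Rightarrow> nat set) \<Rightarrow> nat list \<Rightarrow> nat set" where
  "safe_query n k q hist = (if q hist \<subseteq> {..<n} \<and> card (q hist) = k then q hist else {..<k})"

primrec plan_queries :: "nat \<Rightarrow> nat \<Rightarrow> (nat set \<times> nat \<times> nat) list \<Rightarrow> (nat list \<Rightarrow> nat set) list" where
  "plan_queries n k [] = []"
| "plan_queries n k (s # p) = safe_query n k (plan_query k (Suc (length p)) s) # plan_queries n k p"

lemma plan_queries_of_size:
  assumes "k \<le> n"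
  shows "set (plan_queries n k p) \<subseteq> queries_of_size n k"
  using assms by (induction p) (auto simp: queries_of_size_def safe_query_def)

section \<open>Counting plans and single steps\<close>

lemma finite_plan_steps [simp]: "finite F \<Longrightarrow> finite (plan_steps k U F)"
  unfolding plan_steps_def by (intro finite_SigmaI) (auto intro: finite_subset)

lemma card_plan_steps:
  assumes "finite F"
  shows "card (plan_steps k U F) = (card F choose k) * (k * U)"
proof -
  have "card (plan_steps k U F) = (\<Sum>B | B \<subseteq> F \<and> card B = k. card (B \<times> {..<U}))"
    unfolding plan_steps_def using assms by (intro card_SigmaI) (auto intro: finite_subset)
  also have "\<dots> = (\<Sum>B | B \<subseteq> F \<and> card B = k. k * U)"
    by (intro sum.cong) (auto simp: card_cartesian_product)
  finally show ?thesis using n_subsets[OF assms] by simp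
qed

lemma finite_plans [simp]: "finite F \<Longrightarrow> finite (plans n k m F)"
  by (induction m arbitrary: F) auto

lemma length_plan: "p \<in> plans n k m F \<Longrightarrow> length p = m"
  by (induction m arbitrary: F p) auto

lemma card_plans_filter:
  assumes "finite F"
  shows "card {p \<in> plans n k (Suc m) F. P p} =
    (\<Sum>s\<in>plan_steps k (n + Suc m) F. card {p \<in> plans n k m (F - fst s). P (s # p)})"
proof -
  have "{p \<in> plans n k (Suc m) F. P p} = (\<lambda>(s, p). s # p) `
      (SIGMA s:plan_steps k (n + Suc m) F. {p \<in> plans n k m (F - fst s). P (s # p)})"
    by auto
  also have "card \<dots> = card (SIGMA s:plan_steps k (n + Suc m) F. {p \<in> plans n k m (F - fst s). P (s # p)})"
    by (intro card_image) (auto simp: inj_on_def)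
  also have "\<dots> = (\<Sum>s\<in>plan_steps k (n + Suc m) F. card {p \<in> plans n k m (F - fst s). P (s # p)})"
    using assms by (intro card_SigmaI) auto
  finally show ?thesis .
qed

primrec plan_count :: "nat \<Rightarrow> nat \<Rightarrow> nat \<Rightarrow> nat \<Rightarrow> nat" where
  "plan_count n k 0 f = 1"
| "plan_count n k (Suc m) f = (f choose k) * (k * (n + Suc m)) * plan_count n k m (f - k)"

lemma card_plans:
  assumes "finite F"
  shows "card (plans n k m F) = plan_count n k m (card F)"
  using assms
proof (induction m arbitrary: F)
  case 0
  then show ?case by simp
next
  case (Suc m)
  have "card (plans n k (Suc m) F) = (\<Sum>s\<in>plan_steps k (n + Suc m) F. card (plans n k m (F - fst s)))"
    using card_plans_filter[OF Suc.prems, where P = "\<lambda>_. True"] by simp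
  also have "\<dots> = (\<Sum>s\<in>plan_steps k (n + Suc m) F. plan_count n k m (card F - k))"
  proof (intro sum.cong refl)
    fix s assume "s \<in> plan_steps k (n + Suc m) F"
    then have "fst s \<subseteq> F" "card (fst s) = k" unfolding plan_steps_def by auto
    then have "card (F - fst s) = card F - k" using Suc.prems by (simp add: card_Diff_subset finite_subset)
    then show "card (plans n k m (F - fst s)) = plan_count n k m (card F - k)"
      using Suc.IH[of "F - fst s"] Suc.prems by simp
  qed
  finally show ?case using card_plan_steps[OF Suc.prems, of k "n + Suc m"] by simp
qed

lemma plan_count_pos: "0 < k \<Longrightarrow> m * k \<le> f \<Longrightarrow> 0 < plan_count n k m f"
  by (induction m arbitrary: f) auto

text \<open>Counts the steps that lead to a repeated answer: the replacement happens, and the block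
  misses the other remaining places \<open>S\<close>.\<close>

lemma card_plan_steps_avoid:
  assumes "finite F" "S \<subseteq> F" "c \<le> U"
  shows "card {s \<in> plan_steps k U F. fst s \<inter> S = {} \<and> snd (snd s) < c} =
    (card F - card S choose k) * (k * c)"
proof -
  have "{s \<in> plan_steps k U F. fst s \<inter> S = {} \<and> snd (snd s) < c} = plan_steps k c (F - S)"
    using assms(3) unfolding plan_steps_def by force
  then show ?thesis
    using card_plan_steps[of "F - S" k c] assms by (simp add: card_Diff_subset finite_subset)
qed

text \<open>Counts the steps that lead to the new answer \<open>b\<close>. The block is
  \<open>b\<close> together with \<open>k - 1\<close> places outside \<open>S\<close>; of its
  \<open>k * U\<close> pairs \<open>(x, u)\<close>, exactly the \<open>c\<close> pairs that replace
  \<open>b\<close> itself are lost.\<close>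

lemma card_plan_steps_hit:
  assumes "finite F" "S \<subseteq> F" "b \<in> S" "c \<le> U" "0 < k"
  shows "card {s \<in> plan_steps k U F. fst s \<inter> S = {b} \<and> \<not> (fst (snd s) = b \<and> snd (snd s) < c)} =
    (card F - card S choose (k - 1)) * (k * U - c)"
proof -
  let ?Bs = "{B. B \<subseteq> F \<and> card B = k \<and> B \<inter> S = {b}}"
  have set_eq: "{s \<in> plan_steps k U F. fst s \<inter> S = {b} \<and> \<not> (fst (snd s) = b \<and> snd (snd s) < c)} =
    (SIGMA B:?Bs. B \<times> {..<U} - {b} \<times> {..<c})"
  proof (rule set_eqI)
    fix s :: "nat set \<times> nat \<times> nat"
    obtain B x u where "s = (B, x, u)" by (cases s)
    then show "s \<in> {s \<in> plan_steps k U F. fst s \<inter> S = {b} \<and> \<not> (fst (snd s) = b \<and> snd (snd s) < c)} \<longleftrightarrow>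
        s \<in> (SIGMA B:?Bs. B \<times> {..<U} - {b} \<times> {..<c})"
      unfolding plan_steps_def
      by (simp only: mem_Collect_eq mem_Sigma_iff fst_conv snd_conv Diff_iff singleton_iff lessThan_iff) blast
  qed
  have "card {s \<in> plan_steps k U F. fst s \<inter> S = {b} \<and> \<not> (fst (snd s) = b \<and> snd (snd s) < c)} =
      card (SIGMA B:?Bs. B \<times> {..<U} - {b} \<times> {..<c})" unfolding set_eq ..
  also have "\<dots> = (\<Sum>B\<in>?Bs. card (B \<times> {..<U} - {b} \<times> {..<c}))"
  proof (intro card_SigmaI ballI)
    have "?Bs \<subseteq> Pow F" by blast
    then show "finite ?Bs" using finite_Pow_iff assms(1) finite_subset by metis
    fix B assume "B \<in> ?Bs"
    then have "B \<subseteq> F" by blast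
    then have "finite B" using assms(1) by (rule finite_subset)
    then show "finite (B \<times> {..<U} - {b} \<times> {..<c})" by simp
  qed
  also have "\<dots> = (\<Sum>B\<in>?Bs. k * U - c)"
  proof (intro sum.cong refl)
    fix B assume B: "B \<in> ?Bs"
    then have "b \<in> B" by blast
    then have "{b} \<times> {..<c} \<subseteq> B \<times> {..<U}" using assms(4) by auto
    moreover have "card B = k" using B by blast
    ultimately show "card (B \<times> {..<U} - {b} \<times> {..<c}) = k * U - c"
      by (subst card_Diff_subset) (auto simp: card_cartesian_product)
  qed
  also have "\<dots> = card ?Bs * (k * U - c)" by simp
  also have "card ?Bs = card {B. B \<subseteq> F - S \<and> card B = k - 1}"
  proof (rule bij_betw_same_card[OF bij_betw_byWitness[where f = "\<lambda>B. B - {b}" and f' = "insert b"]])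
    show "\<forall>B\<in>?Bs. insert b (B - {b}) = B" by blast
    show "\<forall>B\<in>{B. B \<subseteq> F - S \<and> card B = k - 1}. insert b B - {b} = B" using assms(3) by blast
    show "(\<lambda>B. B - {b}) ` ?Bs \<subseteq> {B. B \<subseteq> F - S \<and> card B = k - 1}"
    proof clarify
      fix B assume B: "B \<subseteq> F" "B \<inter> S = {b}"
      then have "b \<in> B" by blast
      with B show "B - {b} \<subseteq> F - S \<and> card (B - {b}) = card B - 1"
        by (simp add: card_Diff_singleton) blast
    qed
    show "insert b ` {B. B \<subseteq> F - S \<and> card B = k - 1} \<subseteq> ?Bs"
    proof clarify
      fix B assume B: "B \<subseteq> F - S" "card B = k - 1"
      then have "finite B" using assms(1) finite_subset by blast
      moreover have "b \<notin> B" using B assms(3) by blast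
      ultimately have "card (insert b B) = k" using B(2) assms(5) by simp
      then show "insert b B \<subseteq> F \<and> card (insert b B) = k \<and> insert b B \<inter> S = {b}"
        using B(1) assms(2,3) by blast
    qed
  qed
  also have "\<dots> = (card F - card S choose (k - 1))"
    using n_subsets[of "F - S" "k - 1"] assms by (simp add: card_Diff_subset finite_subset)
  finally show ?thesis .
qed

text \<open>The fraction of plans that find \<^term>\<open>m\<close> missing treasures with \<^term>\<open>l\<close> places other than the last answer, after
  \<^term>\<open>r\<close> distinct answers, when \<^term>\<open>f\<close> places are still unused.\<close>

definition win_ratio :: "nat \<Rightarrow> nat \<Rightarrow> nat \<Rightarrow> nat \<Rightarrow> nat \<Rightarrow> nat \<Rightarrow> real" where
  "win_ratio n k m r f l = fact l * fact (f - l) / fact f * real k ^ m *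
     (fact (n - r) / fact (n - r - l)) * (fact (m + r) / fact (r + l)) * (fact n / fact (n + m))"

text \<open>The factors of \<open>win_ratio\<close> are products over the remaining steps. The first
  counts the orders of the \<open>l\<close> places times the chance that they lie in prescribed
  slots among \<open>f\<close>; every step contributes one factor \<open>k\<close>; new answers
  contribute n-r, n-r-1, ...; repeats contribute m+r, ..., r+l+1; the last factor collects the
  denominators n+m, ..., n+1. A repeat removes one factor \<open>k\<close> and the largest factor
  m+r.\<close>

lemma win_ratio_repeat:
  assumes "l + k \<le> f" "0 < k"
  shows "real ((f choose k) * (k * (n + Suc m))) * win_ratio n k (Suc m) r f l =
    real ((f - l choose k) * (k * (k * (Suc m + r)))) * win_ratio n k m r (f - k) l"
proof -
  obtain g where f: "f = g + l + k" using assms(1) by (metis add.commute add.left_commute le_Suc_ex)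
  have 1: "real (f choose k) = fact f / (fact k * fact (g + l))"
    using f by (subst binomial_fact) auto
  have 2: "real (f - l choose k) = fact (g + k) / (fact k * fact g)"
    using f by (subst binomial_fact) (auto simp: add.commute)
  have 3: "f - l = g + k" "f - k = g + l" "g + l - l = g" using f by auto
  have 4: "fact (Suc m + r) = real (Suc m + r) * fact (m + r)"
    "fact (n + Suc m) = real (n + Suc m) * fact (n + m)" by simp_all
  \<comment> \<open>Factorials are abstracted to real variables, which leaves a plain cancellation
    and prevents the simplifier from expanding them.\<close>
  have "F / (K * GL) * (kk * nn) * (L * GK / F * (kk * p) * (a / b) * (mm * c / e) * (N / (nn * q))) =
      GK / (K * G) * (kk * (kk * mm)) * (L * G / GL * p * (a / b) * (c / e) * (N / q))"
    if "F \<noteq> 0" "K \<noteq> 0" "GL \<noteq> 0" "nn \<noteq> 0" "G \<noteq> 0"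
    for F K GL kk nn L GK p a b mm c e N q G :: real
    using that by (simp add: mult_ac)
  note cancel = this
  show ?thesis
    unfolding win_ratio_def of_nat_mult 1 2 unfolding 3 4 power_Suc
    by (rule cancel) (auto simp del: of_nat_Suc of_nat_add)
qed

text \<open>A new answer can be any of the \<open>Suc l\<close> remaining places. The pairs
  \<open>(x, u)\<close> that keep it number k(n+m) - k(m+r) = k(n-r) with m replaced by
  \<open>Suc m\<close>, which is the next factor of the falling factorial of n-r in
  \<open>win_ratio\<close>.\<close>

lemma win_ratio_fresh:
  assumes "l + k \<le> f" "0 < k" "r + Suc l \<le> n"
  shows "real ((f choose k) * (k * (n + Suc m))) * win_ratio n k (Suc m) r f (Suc l) =
    real (Suc l * ((f - Suc l choose (k - 1)) * (k * (n + Suc m) - k * (Suc m + r)))) *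
      win_ratio n k m (Suc r) (f - k) l"
proof -
  obtain g where f: "f = g + l + k" using assms(1) by (metis add.commute add.left_commute le_Suc_ex)
  obtain j where k: "k = Suc j" using assms(2) gr0_implies_Suc by blast
  obtain e where n: "n = e + r + Suc l" using assms(3) by (metis add.commute add.left_commute le_Suc_ex)
  have 1: "real (f choose k) = fact f / (fact k * fact (g + l))"
    using f by (subst binomial_fact) auto
  have 2: "real (f - Suc l choose (k - 1)) = fact (g + j) / (fact j * fact g)"
    using f k by (subst binomial_fact) (auto simp: add.commute)
  have 3: "f - Suc l = g + j" "f - k = g + l" "g + l - l = g" "n - r = Suc (e + l)"
    "Suc (e + l) - Suc l = e" "n - Suc r = e + l" "e + l - l = e" using f k n by auto
  have 4: "k * (n + Suc m) - k * (Suc m + r) = k * Suc (e + l)"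
    unfolding n diff_mult_distrib2[symmetric] by simp
  have 5: "fact (n + Suc m) = real (n + Suc m) * fact (n + m)" "m + Suc r = Suc m + r" "Suc r + l = r + Suc l"
    "fact (Suc (e + l)) = real (Suc (e + l)) * fact (e + l)" "fact (Suc l) = real (Suc l) * fact l"
    by simp_all
  have 6: "fact k = real k * fact j" unfolding k by simp
  have "F / (kk * J * GL) * (kk * nn) * (sl * L * GK / F * (kk * p) * (t * a / b) * (c / e) * (N / (nn * q))) =
      sl * (GK / (J * G) * (kk * t)) * (L * G / GL * p * (a / b) * (c / e) * (N / q))"
    if "F \<noteq> 0" "J \<noteq> 0" "GL \<noteq> 0" "nn \<noteq> 0" "G \<noteq> 0" "kk \<noteq> 0"
    for F J GL kk nn L GK p a b sl c e N q G t :: real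
    using that by (simp add: mult_ac)
  note cancel = this
  show ?thesis
    unfolding win_ratio_def 4 of_nat_mult 1 2 unfolding 3 5 6 power_Suc
    by (rule cancel) (use assms(2) in \<open>auto simp del: of_nat_Suc of_nat_add\<close>)
qed

lemma win_ratio_first:
  assumes "l + k \<le> n" "0 < k"
  shows "real (Suc l * ((n - Suc l choose (k - 1)) * (k * (n + Suc m)))) * win_ratio n k m 1 (n - k) l =
    real ((n choose k) * (k * (n + Suc m))) * (real k ^ Suc m / real ((n + m) choose Suc m))"
proof -
  obtain g where n: "n = g + l + k" using assms(1) by (metis add.commute add.left_commute le_Suc_ex)
  obtain j where k: "k = Suc j" using assms(2) gr0_implies_Suc by blast
  have 5: "fact n = real n * fact (n - 1)" using n k by (intro fact_reduce) auto
  have 1: "real (n choose k) = (real n * fact (n - 1)) / (fact k * fact (g + l))"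
    unfolding 5[symmetric] using n by (subst binomial_fact) auto
  have 2: "real (n - Suc l choose (k - 1)) = fact (g + j) / (fact j * fact g)"
    using n k by (subst binomial_fact) (auto simp: add.commute)
  have 3: "real ((n + m) choose Suc m) = fact (n + m) / (fact (Suc m) * fact (n - 1))"
    using n k by (subst binomial_fact) auto
  have 4: "n - k = g + l" "g + l - l = g" "n - 1 - l = g + j" using n k by auto
  have 6: "fact k = real k * fact j" unfolding k by simp
  have 7: "fact (1 + l) = real (Suc l) * fact l" "m + 1 = Suc m" by simp_all
  have "sl * (GK / (J * G) * (kk * nn)) * (L * G / GL * p * (N / GK) * (c / (sl * L)) * (n * N / q)) =
    n * N / (kk * J * GL) * (kk * nn) * (kk * p / (q / (c * N)))"
    if "J \<noteq> 0" "GL \<noteq> 0"  "G \<noteq> 0" "kk \<noteq> 0" "sl \<noteq> 0" "L \<noteq> 0" "GK \<noteq> 0" "N \<noteq> 0"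
    for J GL kk nn L GK p sl c q G N n :: real
    using that by (simp add: mult_ac)
  note cancel = this
  show ?thesis
    unfolding win_ratio_def of_nat_mult 1 2 3 unfolding 4 5 6 7 power_Suc
    by (rule cancel) (use assms in \<open>auto simp del: of_nat_Suc of_nat_add\<close>)
qed

section \<open>Lower bounds for the number of winning plans\<close>

lemma card_winning_plans_step:
  fixes c :: real
  assumes "finite F" "A \<subseteq> plan_steps k (n + Suc m) F"
    and "\<And>s. s \<in> A \<Longrightarrow> c \<le> real (card {p \<in> plans n k m (F - fst s).
           forced (safe_query n k (plan_query k (Suc m) s) # plan_queries n k p) hist M})"
  shows "real (card A) * c \<le> real (card {p \<in> plans n k (Suc m) F. forced (plan_queries n k p) hist M})"
proof -
  let ?W = "\<lambda>s. {p \<in> plans n k m (F - fst s). forced (plan_queries n k (s # p)) hist M}"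
  have "real (card A) * c = (\<Sum>s\<in>A. c)" by simp
  also have "\<dots> \<le> (\<Sum>s\<in>A. real (card (?W s)))"
  proof (rule sum_mono)
    fix s assume "s \<in> A"
    moreover have "?W s = {p \<in> plans n k m (F - fst s).
        forced (safe_query n k (plan_query k (Suc m) s) # plan_queries n k p) hist M}"
      using length_plan by auto
    ultimately show "c \<le> real (card (?W s))" using assms(3) by simp
  qed
  also have "\<dots> \<le> (\<Sum>s\<in>plan_steps k (n + Suc m) F. real (card (?W s)))"
    using assms(1,2) by (intro sum_mono2) auto
  also have "\<dots> = real (card {p \<in> plans n k (Suc m) F. forced (plan_queries n k p) hist M})"
    unfolding card_plans_filter[OF assms(1)] by simp
  finally show ?thesis .
qed

lemma forced_ConsI:
  assumes "Q = q hist" "Q \<subseteq> {..<n}" "card Q = k" "Q \<inter> set_mset M = {a}"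
    and "forced qs (a # hist) (M - {#a#})"
  shows "forced (safe_query n k q # qs) hist M"
  using assms by (auto simp: safe_query_def)

text \<open>For different \<open>b\<close> the good steps are disjoint, so their counts add up. A
  replacement of some \<open>x\<close> other than \<open>b\<close> does no harm: the inserted last
  answer lies outside \<open>F\<close> and carries no remaining treasure. The value
  \<open>t = 0\<close> covers the opening query, where there is no last answer to insert.\<close>

lemma card_winning_plans_fresh:
  fixes c :: real
  assumes F: "finite F" "F \<subseteq> {..<n}" and k: "0 < k" and M: "M \<noteq> {#}" "set_mset M \<subseteq> F"
    and hist: "set hist \<subseteq> {..<n}" "set hist \<inter> F = {}"
    and t: "t = (if hist = [] then 0 else k * (Suc m + card (set hist)))" "t \<le> n + Suc m"
    and c: "\<And>b B. b \<in># M \<Longrightarrow> B \<subseteq> F \<Longrightarrow> card B = k \<Longrightarrow> B \<inter> set_mset M = {b} \<Longrightarrow>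
      c \<le> real (card {p \<in> plans n k m (F - B). forced (plan_queries n k p) (b # hist) (M - {#b#})})"
  shows "real (card (set_mset M) * ((card F - card (set_mset M) choose (k - 1)) * (k * (n + Suc m) - t))) * c
    \<le> real (card {p \<in> plans n k (Suc m) F. forced (plan_queries n k p) hist M})"
proof -
  let ?S = "set_mset M"
  define A where "A b = {s \<in> plan_steps k (n + Suc m) F. fst s \<inter> ?S = {b} \<and>
    \<not> (fst (snd s) = b \<and> snd (snd s) < t)}" for b
  have "card (\<Union>b\<in>?S. A b) = (\<Sum>b\<in>?S. card (A b))"
  proof (rule card_UN_disjoint)
    show "\<forall>b\<in>?S. finite (A b)" unfolding A_def using F(1) by simp
    show "\<forall>b\<in>?S. \<forall>b'\<in>?S. b \<noteq> b' \<longrightarrow> A b \<inter> A b' = {}" unfolding A_def by auto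
  qed simp
  also have "\<dots> = (\<Sum>b\<in>?S. (card F - card ?S choose (k - 1)) * (k * (n + Suc m) - t))"
    unfolding A_def by (intro sum.cong refl card_plan_steps_hit F M t k)
  finally have card: "card (\<Union>b\<in>?S. A b) =
      card ?S * ((card F - card ?S choose (k - 1)) * (k * (n + Suc m) - t))" by simp
  show ?thesis unfolding card[symmetric]
  proof (rule card_winning_plans_step[OF F(1)])
    show "(\<Union>b\<in>?S. A b) \<subseteq> plan_steps k (n + Suc m) F" unfolding A_def by auto
    fix s assume "s \<in> (\<Union>b\<in>?S. A b)"
    then obtain b where b: "b \<in># M" "s \<in> A b" by auto
    obtain B x u where s: "s = (B, x, u)" by (cases s)
    have B: "B \<subseteq> F" "card B = k" "x \<in> B" "B \<inter> ?S = {b}" "\<not> (x = b \<and> u < t)"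
      using b(2) unfolding A_def s plan_steps_def by auto
    let ?Q = "plan_query k (Suc m) s hist"
    have "?Q \<subseteq> {..<n} \<and> card ?Q = k \<and> ?Q \<inter> ?S = {b}"
    proof (cases "hist \<noteq> [] \<and> u < t")
      case True
      then have "u < k * (Suc m + card (set hist))" using t(1) by (auto split: if_splits)
      then have Q: "?Q = insert (hd hist) (B - {x})" using True unfolding s by simp
      have hd: "hd hist \<in> set hist" using True by simp
      then have "hd hist \<notin> F" "hd hist < n" using hist by auto
      \<comment> \<open>Since the last answer is outside \<open>F\<close>, it is not in
        \<open>B\<close>, and exchanging it for \<open>x\<close> keeps the query at size
        \<open>k\<close>.\<close>
      moreover have "finite B" using B(1) F(1) finite_subset by blast
      ultimately show ?thesis unfolding Q using B True F M k by (auto simp: card_insert_if)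
    next
      case False
      then have "\<not> (hist \<noteq> [] \<and> u < k * (Suc m + card (set hist)))" using t(1) by (auto split: if_splits)
      then have "?Q = B" unfolding s by (simp only: plan_query.simps if_False)
      then show ?thesis using B F by auto
    qed
    then have "{p \<in> plans n k m (F - B). forced (plan_queries n k p) (b # hist) (M - {#b#})} \<subseteq>
        {p \<in> plans n k m (F - fst s). forced (safe_query n k (plan_query k (Suc m) s) # plan_queries n k p) hist M}"
      using forced_ConsI[OF refl, of "plan_query k (Suc m) s" hist n k M b] unfolding s by auto
    then have "card {p \<in> plans n k m (F - B). forced (plan_queries n k p) (b # hist) (M - {#b#})} \<le>
        card {p \<in> plans n k m (F - fst s). forced (safe_query n k (plan_query k (Suc m) s) # plan_queries n k p) hist M}"
      using F(1) by (intro card_mono) auto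
    with c[OF b(1) B(1,2,4)] show "c \<le> real (card {p \<in> plans n k m (F - fst s).
        forced (safe_query n k (plan_query k (Suc m) s) # plan_queries n k p) hist M})" by linarith
  qed
qed

text \<open>While the place of the last answer still holds a treasure, the next query has to return
  it: only the last answer can be inserted, and no used place returns to \<open>F\<close>. So
  treasures of one place are answered consecutively.\<close>

lemma card_winning_plans_repeat:
  fixes c :: real
  assumes F: "finite F" "F \<subseteq> {..<n}" and k: "0 < k" and M: "hd hist \<in># M" "set_mset M \<subseteq> insert (hd hist) F"
    and hist: "hist \<noteq> []" "set hist \<subseteq> {..<n}" "set hist \<inter> F = {}"
    and t: "k * (Suc m + card (set hist)) \<le> n + Suc m"
    and c: "\<And>B. B \<subseteq> F \<Longrightarrow> card B = k \<Longrightarrow> B \<inter> set_mset M = {} \<Longrightarrow>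
      c \<le> real (card {p \<in> plans n k m (F - B). forced (plan_queries n k p) (hd hist # hist) (M - {#hd hist#})})"
  shows "real ((card F - card (set_mset M - {hd hist}) choose k) * (k * (k * (Suc m + card (set hist))))) * c
    \<le> real (card {p \<in> plans n k (Suc m) F. forced (plan_queries n k p) hist M})"
proof -
  let ?S = "set_mset M - {hd hist}" and ?t = "k * (Suc m + card (set hist))"
  let ?A = "{s \<in> plan_steps k (n + Suc m) F. fst s \<inter> ?S = {} \<and> snd (snd s) < ?t}"
  have "hd hist \<in> set hist" using hist(1) by simp
  then have hd: "hd hist \<notin> F" "hd hist < n" using hist(2,3) by blast+
  have card: "card ?A = (card F - card ?S choose k) * (k * ?t)"
    by (rule card_plan_steps_avoid[OF F(1) _ t]) (use M in auto)
  show ?thesis unfolding card[symmetric]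
  proof (rule card_winning_plans_step[OF F(1)])
    show "?A \<subseteq> plan_steps k (n + Suc m) F" by auto
    fix s assume sA: "s \<in> ?A"
    obtain B x u where s: "s = (B, x, u)" by (cases s)
    have B: "B \<subseteq> F" "card B = k" "x \<in> B" "B \<inter> set_mset M = {}" "u < ?t"
      using sA hd unfolding s plan_steps_def by auto
    let ?Q = "plan_query k (Suc m) s hist"
    have Q: "?Q = insert (hd hist) (B - {x})" using B(5) hist(1) unfolding s by simp
    have "finite B" using B(1) F(1) finite_subset by blast
    then have "?Q \<subseteq> {..<n} \<and> card ?Q = k \<and> ?Q \<inter> set_mset M = {hd hist}"
      unfolding Q using B F M k hd by (auto simp: card_insert_if)
    then have "{p \<in> plans n k m (F - B). forced (plan_queries n k p) (hd hist # hist) (M - {#hd hist#})} \<subseteq>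
        {p \<in> plans n k m (F - fst s). forced (safe_query n k (plan_query k (Suc m) s) # plan_queries n k p) hist M}"
      using forced_ConsI[OF refl, of "plan_query k (Suc m) s" hist n k M "hd hist"] unfolding s by auto
    then have "card {p \<in> plans n k m (F - B). forced (plan_queries n k p) (hd hist # hist) (M - {#hd hist#})} \<le>
        card {p \<in> plans n k m (F - fst s). forced (safe_query n k (plan_query k (Suc m) s) # plan_queries n k p) hist M}"
      using F(1) by (intro card_mono) auto
    with c[OF B(1,2,4)] show "c \<le> real (card {p \<in> plans n k m (F - fst s).
        forced (safe_query n k (plan_query k (Suc m) s) # plan_queries n k p) hist M})" by linarith
  qed
qed

lemma card_set_mset_le_size: "card (set_mset M) \<le> size M"
  by (induction M) (auto simp: card_insert_if)

text \<open>The invariant \<open>set_mset M \<subseteq> insert (hd hist) F\<close> expresses that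
  places answered earlier are exhausted. The bound \<open>k * (m + card (set hist)) \<le> n\<close>
  keeps the replacement threshold within range and survives because m+r never grows;
  \<open>m * Suc k \<le> card F\<close> leaves room for a block next to the remaining
  places.\<close>

lemma win_ratio_le_card_winning_plans:
  assumes "finite F" "F \<subseteq> {..<n}" "0 < k" "size M = m" "set_mset M \<subseteq> insert (hd hist) F"
    and "hist \<noteq> []" "set hist \<subseteq> {..<n}" "set hist \<inter> F = {}"
    and "k * (m + card (set hist)) \<le> n" "m * Suc k \<le> card F"
  shows "win_ratio n k m (card (set hist)) (card F) (card (set_mset M - {hd hist})) * real (plan_count n k m (card F))
    \<le> real (card {p \<in> plans n k m F. forced (plan_queries n k p) hist M})"
  using assms
proof (induction m arbitrary: F M hist)
  case 0
  then have "{p \<in> plans n k 0 F. forced (plan_queries n k p) hist M} = {[]}" by auto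
  then show ?case using 0 by (simp add: win_ratio_def)
next
  case (Suc m)
  let ?r = "card (set hist)" and ?f = "card F" and ?l = "card (set_mset M - {hd hist})"
  have hd: "hd hist \<in> set hist" "hd hist \<notin> F" using Suc.prems(6,8) by (auto dest: hd_in_set)
  have "?l \<le> card (set_mset M)" by (intro card_mono) auto
  then have "?l \<le> Suc m" using card_set_mset_le_size[of M] Suc.prems(4) by linarith
  moreover have "k \<le> Suc m * k" by simp
  ultimately have lf: "?l + k \<le> ?f" using Suc.prems(10) unfolding mult_Suc_right by linarith
  have cardB: "card (F - B) = ?f - k" "m * Suc k \<le> card (F - B)" if "B \<subseteq> F" "card B = k" for B
    using that Suc.prems(1,10) by (auto simp: card_Diff_subset finite_subset)
  have t: "k * (Suc m + ?r) \<le> n + Suc m" using Suc.prems(9) by linarith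
  have shuffle: "w * (a * p) = x * (w' * p)" if "a * w = x * w'" for a w x w' p :: real
  proof -
    have "w * (a * p) = (a * w) * p" by (simp only: mult_ac)
    also have "\<dots> = x * (w' * p)" unfolding that by (simp only: mult.assoc)
    finally show ?thesis .
  qed
  show ?case
  proof (cases "hd hist \<in># M")
    case True
    let ?c = "win_ratio n k m ?r (?f - k) ?l * real (plan_count n k m (?f - k))"
    have "real ((?f - ?l choose k) * (k * (k * (Suc m + ?r)))) * ?c
      \<le> real (card {p \<in> plans n k (Suc m) F. forced (plan_queries n k p) hist M})"
    proof (rule card_winning_plans_repeat[OF Suc.prems(1,2,3) True Suc.prems(5,6,7,8) t])
      fix B assume B: "B \<subseteq> F" "card B = k" "B \<inter> set_mset M = {}"
      have S: "set_mset (M - {#hd hist#}) - {hd (hd hist # hist)} = set_mset M - {hd hist}"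
        by (auto dest: in_diffD simp: in_diff_count)
      show "?c \<le> real (card {p \<in> plans n k m (F - B).
          forced (plan_queries n k p) (hd hist # hist) (M - {#hd hist#})})"
      proof -
        have "size (M - {#hd hist#}) = m" using True Suc.prems(4) by (simp add: size_Diff_singleton)
        moreover have "set_mset (M - {#hd hist#}) \<subseteq> insert (hd (hd hist # hist)) (F - B)"
          using Suc.prems(5) B(3) by (auto dest: in_diffD)
        moreover have "set (hd hist # hist) = set hist" using hd by auto
        moreover have "k * (m + ?r) \<le> n" using Suc.prems(9) by simp
        ultimately show ?thesis
          using Suc.IH[of "F - B" "M - {#hd hist#}" "hd hist # hist"] Suc.prems(1-3,7,8) cardB[OF B(1,2)]
          unfolding S by (simp only:) blast
      qed
    qed
    moreover
    have "real ((?f choose k) * (k * (n + Suc m))) * win_ratio n k (Suc m) ?r ?f ?l =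
       real ((?f - ?l choose k) * (k * (k * (Suc m + ?r)))) * win_ratio n k m ?r (?f - k) ?l"
      by (rule win_ratio_repeat[OF lf Suc.prems(3)])
    note shuffle[OF this, of "real (plan_count n k m (?f - k))"]
    ultimately show ?thesis
      unfolding plan_count.simps(2) of_nat_mult[of "(?f choose k) * (k * (n + Suc m))"] by (simp only:)
  next
    case False
    then have S: "set_mset M - {hd hist} = set_mset M" and MF: "set_mset M \<subseteq> F" and "M \<noteq> {#}"
      using Suc.prems(4,5) by auto
    then obtain l where l: "card (set_mset M) = Suc l"
      by (metis card_0_eq finite_set_mset not0_implies_Suc set_mset_eq_empty_iff)
    let ?c = "win_ratio n k m (Suc ?r) (?f - k) l * real (plan_count n k m (?f - k))"
    have "real (card (set_mset M) * ((?f - card (set_mset M) choose (k - 1)) * (k * (n + Suc m) - k * (Suc m + ?r)))) * ?c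
      \<le> real (card {p \<in> plans n k (Suc m) F. forced (plan_queries n k p) hist M})"
    proof (rule card_winning_plans_fresh[OF Suc.prems(1,2,3) \<open>M \<noteq> {#}\<close> MF Suc.prems(7,8) _ t])
      show "k * (Suc m + ?r) = (if hist = [] then 0 else k * (Suc m + ?r))" using Suc.prems(6) by simp
      fix b B assume B: "b \<in># M" "B \<subseteq> F" "card B = k" "B \<inter> set_mset M = {b}"
      have b: "b \<notin> set hist" using B(1) MF Suc.prems(8) by auto
      have S': "set_mset (M - {#b#}) - {hd (b # hist)} = set_mset M - {b}"
        by (auto dest: in_diffD simp: in_diff_count)
      show "?c \<le> real (card {p \<in> plans n k m (F - B).
          forced (plan_queries n k p) (b # hist) (M - {#b#})})"
      proof -
        have "size (M - {#b#}) = m" using B(1) Suc.prems(4) by (simp add: size_Diff_singleton)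
        moreover have "set_mset (M - {#b#}) \<subseteq> insert (hd (b # hist)) (F - B)"
          using MF B(4) by (auto dest: in_diffD)
        moreover have "card (set (b # hist)) = Suc ?r" using b by simp
        moreover have "k * (m + Suc ?r) \<le> n" using Suc.prems(9) by simp
        moreover have "card (set_mset M - {b}) = l" using B(1) l by simp
        moreover have "set (b # hist) \<subseteq> {..<n}" "set (b # hist) \<inter> (F - B) = {}"
          using Suc.prems(2,7,8) B MF by auto
        ultimately show ?thesis
          using Suc.IH[of "F - B" "M - {#b#}" "b # hist"] Suc.prems(1-3) cardB[OF B(2,3)]
          unfolding S' by (simp only:) blast
      qed
    qed
    moreover
    have "?r + Suc l \<le> n"
    proof -
      have "?r + Suc l = card (set hist \<union> set_mset M)"
        unfolding l[symmetric] using MF Suc.prems(8) by (intro card_Un_disjoint[symmetric]) auto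
      also have "\<dots> \<le> card {..<n}" using MF Suc.prems(2,7) by (intro card_mono) auto
      finally show ?thesis by simp
    qed
    then have "real ((?f choose k) * (k * (n + Suc m))) * win_ratio n k (Suc m) ?r ?f (Suc l) =
       real (Suc l * ((?f - Suc l choose (k - 1)) * (k * (n + Suc m) - k * (Suc m + ?r)))) *
         win_ratio n k m (Suc ?r) (?f - k) l"
      using lf l unfolding S by (intro win_ratio_fresh Suc.prems(3)) auto
    note shuffle[OF this, of "real (plan_count n k m (?f - k))"]
    ultimately show ?thesis
      unfolding S plan_count.simps(2) l of_nat_mult[of "(?f choose k) * (k * (n + Suc m))"] by (simp only:)
  qed
qed

lemma card_forced_plans_ge:
  assumes "0 < k" "d * Suc k \<le> n" "0 < d" "size M = d" "set_mset M \<subseteq> {..<n}"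
  shows "real k ^ d / real ((n + d - 1) choose d) * real (card (plans n k d {..<n}))
    \<le> real (card {p \<in> plans n k d {..<n}. forced (plan_queries n k p) [] M})"
proof -
  obtain m where d: "d = Suc m" using assms(3) gr0_implies_Suc by blast
  have "M \<noteq> {#}" using assms(3,4) by auto
  then obtain l where l: "card (set_mset M) = Suc l"
    by (metis card_0_eq finite_set_mset not0_implies_Suc set_mset_eq_empty_iff)
  have "Suc l \<le> Suc m" using card_set_mset_le_size[of M] l assms(4) d by simp
  moreover have "k \<le> Suc m * k" by simp
  ultimately have lk: "l + k \<le> n" using assms(2) unfolding d mult_Suc_right by linarith
  let ?c = "win_ratio n k m 1 (n - k) l * real (plan_count n k m (n - k))"
  have "real (card (set_mset M) * ((card {..<n} - card (set_mset M) choose (k - 1)) * (k * (n + Suc m) - 0))) * ?c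
      \<le> real (card {p \<in> plans n k (Suc m) {..<n}. forced (plan_queries n k p) [] M})"
  proof (rule card_winning_plans_fresh[OF _ _ assms(1) \<open>M \<noteq> {#}\<close> assms(5)])
    fix b B assume B: "b \<in># M" "B \<subseteq> {..<n}" "card B = k" "B \<inter> set_mset M = {b}"
    have cB: "card ({..<n} - B) = n - k" using B(2,3) by (simp add: card_Diff_subset finite_subset)
    have "b < n" "b \<in> B" using B(1,4) assms(5) by blast+
    have S: "card (set_mset (M - {#b#}) - {hd [b]}) = l"
    proof -
      have "set_mset (M - {#b#}) - {hd [b]} = set_mset M - {b}"
        by (auto dest: in_diffD simp: in_diff_count)
      then show ?thesis using B(1) l by simp
    qed
    have "win_ratio n k m (card (set [b])) (card ({..<n} - B)) (card (set_mset (M - {#b#}) - {hd [b]})) *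
        real (plan_count n k m (card ({..<n} - B)))
      \<le> real (card {p \<in> plans n k m ({..<n} - B). forced (plan_queries n k p) [b] (M - {#b#})})"
    proof (rule win_ratio_le_card_winning_plans[OF _ _ assms(1)])
      show "size (M - {#b#}) = m" using B(1) assms(4) d by (simp add: size_Diff_singleton)
      show "set_mset (M - {#b#}) \<subseteq> insert (hd [b]) ({..<n} - B)"
        using assms(5) B(4) by (auto dest: in_diffD)
      show "k * (m + card (set [b])) \<le> n" "m * Suc k \<le> card ({..<n} - B)"
        using assms(2) unfolding d cB by (auto simp: algebra_simps)
    qed (use \<open>b < n\<close> \<open>b \<in> B\<close> in auto)
    then show "?c \<le> real (card {p \<in> plans n k m ({..<n} - B). forced (plan_queries n k p) [b] (M - {#b#})})"
      unfolding S cB by simp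
  qed auto
  also have "real (card (set_mset M) * ((card {..<n} - card (set_mset M) choose (k - 1)) * (k * (n + Suc m) - 0))) * ?c
      = real ((n choose k) * (k * (n + Suc m))) * (real k ^ Suc m / real ((n + m) choose Suc m)) *
        real (plan_count n k m (n - k))"
    using win_ratio_first[OF lk assms(1), of m] unfolding l diff_zero card_lessThan
    by (metis mult.assoc)
  also have "\<dots> = real k ^ d / real ((n + d - 1) choose d) * real (card (plans n k d {..<n}))"
    unfolding card_plans[OF finite_lessThan] d plan_count.simps(2) card_lessThan
    by (simp del: power_Suc binomial_Suc_Suc)
  finally show ?thesis unfolding d .
qed

text \<open>The guarantee is a count over an indexed finite family, since distinct plans may induce
  the same strategy. In this form it gives both the uniform mixture for \<open>lower_value\<close>
  and an average against any hider for \<open>upper_value\<close>.\<close>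

lemma searcher_guarantee:
  assumes "0 < k" "d * Suc k \<le> n" "0 < d"
  obtains P :: "(nat set \<times> nat \<times> nat) list set" and \<sigma>
  where "finite P" "P \<noteq> {}" "\<sigma> ` P \<subseteq> searcher_strategies n d k"
    "\<And>C. valid_config n d C \<Longrightarrow> real k ^ d / real ((n + d - 1) choose d) * real (card P)
       \<le> real (card {p \<in> P. searcher_wins d k (\<sigma> p) C})"
proof
  let ?P = "plans n k d {..<n}" and ?\<sigma> = "\<lambda>p. dig_strategy d k (plan_queries n k p)"
  have kn: "k \<le> n" using assms(2,3) by (cases d) auto
  show "finite ?P" by simp
  have "d * k \<le> n" using assms(2) by simp
  then have "0 < card ?P" unfolding card_plans[OF finite_lessThan] using assms(1) by (intro plan_count_pos) auto
  then show "?P \<noteq> {}" by auto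
  show "?\<sigma> ` ?P \<subseteq> searcher_strategies n d k"
    using dig_strategy_in_searcher_strategies[OF plan_queries_of_size[OF kn] assms(1) kn] by blast
  fix C assume C: "valid_config n d C"
  let ?M = "image_mset (fst \<circ> snd C) (mset_set {..<d})"
  have "set_mset ?M \<subseteq> {..<n}" using C unfolding valid_config_def by auto
  then have "real k ^ d / real ((n + d - 1) choose d) * real (card ?P)
      \<le> real (card {p \<in> ?P. forced (plan_queries n k p) [] ?M})"
    by (intro card_forced_plans_ge assms) auto
  also have "\<dots> \<le> real (card {p \<in> ?P. searcher_wins d k (?\<sigma> p) C})"
    using forced_imp_searcher_wins[OF C assms(1)] by (intro of_nat_mono card_mono) auto
  finally show "real k ^ d / real ((n + d - 1) choose d) * real (card ?P)
       \<le> real (card {p \<in> ?P. searcher_wins d k (?\<sigma> p) C})" .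
qed

section \<open>Hiding on a grid\<close>

definition hole_start :: "nat list \<Rightarrow> nat \<Rightarrow> nat" where
  "hole_start cs i = sum_list (take i cs)"

definition hole_of :: "nat list \<Rightarrow> nat \<Rightarrow> nat" where
  "hole_of cs j = (LEAST i. j < hole_start cs (Suc i))"

text \<open>The prepended 0 is the start of the segment, so that treasure \<open>j\<close>, counted
  from 0, sits at \<open>mark U (Suc j)\<close> and the hole of index \<open>i\<close> begins at
  \<open>mark U (hole_start cs i)\<close>.\<close>

definition mark :: "nat set \<Rightarrow> nat \<Rightarrow> nat" where
  "mark U j = (0 # sorted_list_of_set U) ! j"

definition cell :: "nat list \<times> nat set \<Rightarrow> nat \<Rightarrow> nat \<times> nat" where
  "cell = (\<lambda>(cs, U) j. (hole_of cs j, mark U (Suc j) - mark U (hole_start cs (hole_of cs j))))"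

definition cell_position :: "nat \<Rightarrow> nat \<times> nat \<Rightarrow> nat \<times> real" where
  "cell_position m c = (fst c, real (snd c) / real m)"

text \<open>Every hole ends at its deepest treasure and a hole without treasure has depth 0, so the
  total depth telescopes to the last mark divided by \<open>m\<close>.\<close>

definition grid_config :: "nat \<Rightarrow> nat list \<times> nat set \<Rightarrow> hider_config" where
  "grid_config m = (\<lambda>(cs, U).
    (\<lambda>i. (real (mark U (hole_start cs (Suc i))) - real (mark U (hole_start cs i))) / real m,
     \<lambda>j. cell_position m (cell (cs, U) j)))"

text \<open>Lay the holes one after another along a segment of length \<^term>\<open>m\<close>: \<^term>\<open>U\<close> is the set of
  the \<^term>\<open>d\<close> positions that carry a treasure, and \<^term>\<open>cs\<close> lists how many of them each hole receives.\<close>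

definition layouts :: "nat \<Rightarrow> nat \<Rightarrow> nat \<Rightarrow> (nat list \<times> nat set) set" where
  "layouts n d m = {cs. length cs = n \<and> sum_list cs = d} \<times> {U. U \<subseteq> {1..m} \<and> card U = d}"

lemma finite_layouts: "finite (layouts n d m)"
proof -
  have "{cs. length cs = n \<and> sum_list cs = d} \<subseteq> {cs. set cs \<subseteq> {..d} \<and> length cs = n}"
    using member_le_sum_list by fastforce
  then have "finite {cs. length cs = n \<and> sum_list cs = d}"
    using finite_lists_length_eq[of "{..d}" n] finite_subset by blast
  then show ?thesis unfolding layouts_def by auto
qed

lemma card_layouts: "card (layouts n d m) = ((n + d - 1) choose d) * (m choose d)"
  unfolding layouts_def
  by (simp add: card_cartesian_product card_length_sum_list n_subsets add.commute)

lemma hole_start_0 [simp]: "hole_start cs 0 = 0"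
  unfolding hole_start_def by simp

lemma hole_start_Suc: "i < length cs \<Longrightarrow> hole_start cs (Suc i) = hole_start cs i + cs ! i"
  unfolding hole_start_def by (simp add: take_Suc_conv_app_nth)

lemma hole_start_length: "hole_start cs (length cs) = sum_list cs"
  unfolding hole_start_def by simp

lemma hole_start_mono: "i \<le> i' \<Longrightarrow> hole_start cs i \<le> hole_start cs i'"
proof (induction i' rule: dec_induct)
  case (step i')
  have "hole_start cs i' \<le> hole_start cs (Suc i')"
    by (cases "i' < length cs") (auto simp: hole_start_Suc, simp add: hole_start_def)
  with step show ?case by simp
qed simp

lemma hole_start_le: "hole_start cs i \<le> sum_list cs"
  unfolding hole_start_def by (metis append_take_drop_id le_add1 sum_list_append)

lemma hole_of_eqI: "hole_start cs i \<le> j \<Longrightarrow> j < hole_start cs (Suc i) \<Longrightarrow> hole_of cs j = i"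
  unfolding hole_of_def
proof (rule Least_equality)
  fix y assume "hole_start cs i \<le> j" "j < hole_start cs (Suc y)"
  then have "\<not> hole_start cs (Suc y) \<le> hole_start cs i" by simp
  then have "\<not> Suc y \<le> i" using hole_start_mono by blast
  then show "i \<le> y" by simp
qed

lemma hole_of:
  assumes "j < sum_list cs"
  shows "hole_of cs j < length cs" "hole_start cs (hole_of cs j) \<le> j" "j < hole_start cs (Suc (hole_of cs j))"
proof -
  have "0 < length cs" using assms by (cases cs) auto
  then have ex: "j < hole_start cs (Suc (length cs - 1))" using assms by (simp add: hole_start_length)
  show "j < hole_start cs (Suc (hole_of cs j))" unfolding hole_of_def using ex by (rule LeastI)
  have "hole_of cs j \<le> length cs - 1" unfolding hole_of_def using ex by (rule Least_le)
  then show "hole_of cs j < length cs" using \<open>0 < length cs\<close> by linarith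
  show "hole_start cs (hole_of cs j) \<le> j"
  proof (cases "hole_of cs j")
    case (Suc i)
    then have "i < hole_of cs j" by simp
    then have "\<not> j < hole_start cs (Suc i)" unfolding hole_of_def by (rule not_less_Least)
    then show ?thesis using Suc by simp
  qed simp
qed

context
  fixes U :: "nat set" and m d :: nat
  assumes U: "U \<subseteq> {1..m}" "card U = d"
begin

lemma mark_0 [simp]: "mark U 0 = 0"
  unfolding mark_def by simp

lemma finite_U: "finite U"
  using U(1) finite_subset by blast

lemma mark_Suc_mem: "j < d \<Longrightarrow> mark U (Suc j) \<in> U"
  unfolding mark_def using finite_U U(2) by (metis length_sorted_list_of_set nth_Cons_Suc nth_mem set_sorted_list_of_set)

lemma mark_le: "j \<le> d \<Longrightarrow> mark U j \<le> m"
  using mark_Suc_mem[of "j - 1"] U(1) by (cases j) auto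

lemma mark_strict_mono: "i < j \<Longrightarrow> j \<le> d \<Longrightarrow> mark U i < mark U j"
proof (cases i)
  case 0
  assume "i < j" "j \<le> d"
  then have "mark U j \<in> U" using mark_Suc_mem[of "j - 1"] by simp
  then show ?thesis using 0 U(1) by auto
next
  case (Suc i')
  assume ij: "i < j" "j \<le> d"
  then obtain j' where j: "j = Suc j'" using gr0_implies_Suc by (metis not_less_zero not_gr_zero)
  have "sorted_list_of_set U ! i' < sorted_list_of_set U ! j'"
    using ij Suc j finite_U U(2) strict_sorted_list_of_set[of U]
    by (auto simp: sorted_wrt_iff_nth_less)
  then show ?thesis unfolding Suc j mark_def by simp
qed

lemma mark_mono: "i \<le> j \<Longrightarrow> j \<le> d \<Longrightarrow> mark U i \<le> mark U j"
  using mark_strict_mono[of i j] by (cases "i = j") auto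

lemma image_mark: "(\<lambda>j. mark U (Suc j)) ` {..<d} = U"
proof -
  have "U = set (sorted_list_of_set U)" using finite_U by simp
  also have "\<dots> = (\<lambda>j. sorted_list_of_set U ! j) ` {..<d}"
    using finite_U U(2) by (auto simp: set_conv_nth)
  finally show ?thesis unfolding mark_def by simp
qed

end

lemma strict_mono_image_unique:
  fixes f g :: "nat \<Rightarrow> nat"
  assumes "\<And>i j. a \<le> i \<Longrightarrow> i < j \<Longrightarrow> j < b \<Longrightarrow> f i < f j" "\<And>i j. a \<le> i \<Longrightarrow> i < j \<Longrightarrow> j < b \<Longrightarrow> g i < g j"
    and "f ` {a..<b} = g ` {a..<b}" "a \<le> j" "j < b"
  shows "f j = g j"
proof -
  have "sorted_wrt (<) (map f [a..<b])" "sorted_wrt (<) (map g [a..<b])"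
    using assms(1,2) by (auto simp: sorted_wrt_iff_nth_less)
  then have "map f [a..<b] = map g [a..<b]"
    using assms(3) by (intro strict_sorted_equal) auto
  then show ?thesis using assms(4,5) by simp
qed

lemma layoutsD:
  assumes "(cs, U) \<in> layouts n d m"
  shows "length cs = n" "sum_list cs = d" "U \<subseteq> {1..m}" "card U = d"
  using assms unfolding layouts_def by auto

text \<open>Strictly increasing marks give depth at least one cell. This is essential for the count:
  a treasure at the surface would be found for free, without using up a cell of the budget.\<close>

lemma cell_props:
  assumes "(cs, U) \<in> layouts n d m" "j < d"
  shows "fst (cell (cs, U) j) < n" "1 \<le> snd (cell (cs, U) j)"
    "snd (cell (cs, U) j) \<le> mark U (hole_start cs (Suc (fst (cell (cs, U) j)))) - mark U (hole_start cs (fst (cell (cs, U) j)))"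
proof -
  note L = layoutsD[OF assms(1)]
  have j: "j < sum_list cs" using L(2) assms(2) by simp
  note h = hole_of[OF j]
  show "fst (cell (cs, U) j) < n" using h(1) L(1) unfolding cell_def by simp
  have "hole_start cs (hole_of cs j) < Suc j" "Suc j \<le> d" using h(2) assms(2) by auto
  from mark_strict_mono[OF L(3,4) this] show "1 \<le> snd (cell (cs, U) j)" unfolding cell_def by simp
  have "Suc j \<le> hole_start cs (Suc (hole_of cs j))" "hole_start cs (Suc (hole_of cs j)) \<le> d"
    using h(3) hole_start_le[of cs] L(2) by auto
  from mark_mono[OF L(3,4) this]
  show "snd (cell (cs, U) j) \<le> mark U (hole_start cs (Suc (fst (cell (cs, U) j)))) - mark U (hole_start cs (fst (cell (cs, U) j)))"
    unfolding cell_def by simp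
qed

lemma inj_on_cell:
  assumes "(cs, U) \<in> layouts n d m"
  shows "inj_on (cell (cs, U)) {..<d}"
proof (rule linorder_inj_onI')
  fix i j assume ij: "i \<in> {..<d}" "j \<in> {..<d}" "i < j"
  note L = layoutsD[OF assms]
  show "cell (cs, U) i \<noteq> cell (cs, U) j"
  proof
    assume eq: "cell (cs, U) i = cell (cs, U) j"
    then have h: "hole_of cs i = hole_of cs j" unfolding cell_def by simp
    have "hole_start cs (hole_of cs j) < Suc i" using hole_of(2)[of i cs] ij L(2) h by simp
    then have "mark U (hole_start cs (hole_of cs j)) < mark U (Suc i)" "mark U (Suc i) < mark U (Suc j)"
      using mark_strict_mono[OF L(3,4)] ij by auto
    then show False using eq unfolding cell_def by (simp add: h)
  qed
qed

lemma valid_grid_config: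
  assumes "\<omega> \<in> layouts n d m" "0 < m"
  shows "valid_config n d (grid_config m \<omega>)"
proof -
  obtain cs U where \<omega>: "\<omega> = (cs, U)" by (cases \<omega>)
  note L = layoutsD[OF assms(1)[unfolded \<omega>]]
  let ?u = "\<lambda>i. mark U (hole_start cs i)"
  have u: "?u i \<le> ?u (Suc i)" for i
    using mark_mono[OF L(3,4)] hole_start_mono[of i "Suc i" cs] hole_start_le[of cs] L(2) by simp
  have "(\<Sum>i<n. (real (?u (Suc i)) - real (?u i)) / real m) = (\<Sum>i<n. real (?u (Suc i)) - real (?u i)) / real m"
    by (simp add: sum_divide_distrib)
  also have "\<dots> = real (?u n) / real m"
    using mark_0[OF L(3,4)] by (subst sum_lessThan_telescope[of "\<lambda>i. real (?u i)"]) simp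
  also have "\<dots> \<le> 1"
    using mark_le[OF L(3,4), of d] hole_start_length[of cs] L(1,2) assms(2) by simp
  finally have "(\<Sum>i<n. (real (?u (Suc i)) - real (?u i)) / real m) \<le> 1" .
  \<comment> \<open>The bound in \<open>cell_props\<close> is a truncated difference of naturals;
    monotonicity \<open>u\<close> turns it into the real difference.\<close>
  moreover have "real (snd (cell (cs, U) j)) / real m \<le>
      (real (?u (Suc (fst (cell (cs, U) j)))) - real (?u (fst (cell (cs, U) j)))) / real m" if "j < d" for j
    using cell_props(3)[OF assms(1)[unfolded \<omega>] that] u[of "fst (cell (cs, U) j)"]
    by (intro divide_right_mono) linarith+
  ultimately show ?thesis
    using u cell_props(1)[OF assms(1)[unfolded \<omega>]]
    unfolding valid_config_def grid_config_def \<omega> cell_position_def by (auto intro!: divide_nonneg_nonneg)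
qed

lemma cells_of_hole:
  assumes "(cs, U) \<in> layouts n d m" "i < n"
  shows "{c \<in> cell (cs, U) ` {..<d}. fst c = i} = cell (cs, U) ` {hole_start cs i..<hole_start cs (Suc i)}"
proof -
  note L = layoutsD[OF assms(1)]
  have le: "hole_start cs (Suc i) \<le> d" using hole_start_le[of cs "Suc i"] L(2) by simp
  have fst_cell: "fst (cell (cs, U) j) = hole_of cs j" for j unfolding cell_def by simp
  have "j < d \<and> hole_of cs j = i \<longleftrightarrow> hole_start cs i \<le> j \<and> j < hole_start cs (Suc i)" for j
  proof
    assume "j < d \<and> hole_of cs j = i"
    then show "hole_start cs i \<le> j \<and> j < hole_start cs (Suc i)" using hole_of(2,3)[of j cs] L(2) by blast
  next
    assume j: "hole_start cs i \<le> j \<and> j < hole_start cs (Suc i)"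
    then show "j < d \<and> hole_of cs j = i" using hole_of_eqI[of cs i j] le by linarith
  qed
  then have "{j \<in> {..<d}. hole_of cs j = i} = {hole_start cs i..<hole_start cs (Suc i)}"
    unfolding set_eq_iff by simp
  moreover have "{c \<in> cell (cs, U) ` {..<d}. fst c = i} = cell (cs, U) ` {j \<in> {..<d}. hole_of cs j = i}"
    unfolding fst_cell[symmetric] by blast
  ultimately show ?thesis by simp
qed

text \<open>The number of cells at each place gives back \<open>cs\<close>. The marks are recovered
  hole by hole: the start of the hole is known inductively, and within it the depths increase with
  the index, so their set determines their sequence.\<close>

lemma inj_on_cells: "inj_on (\<lambda>\<omega>. cell \<omega> ` {..<d}) (layouts n d m)"
proof (rule inj_onI)
  fix \<omega> \<omega>' assume \<omega>: "\<omega> \<in> layouts n d m" and \<omega>': "\<omega>' \<in> layouts n d m"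
    and eq: "cell \<omega> ` {..<d} = cell \<omega>' ` {..<d}"
  obtain cs U where cU: "\<omega> = (cs, U)" by (cases \<omega>)
  obtain cs' U' where cU': "\<omega>' = (cs', U')" by (cases \<omega>')
  note L = layoutsD[OF \<omega>[unfolded cU]] and L' = layoutsD[OF \<omega>'[unfolded cU']]
  have block: "cell (cs, U) ` {hole_start cs i..<hole_start cs (Suc i)} =
      cell (cs', U') ` {hole_start cs' i..<hole_start cs' (Suc i)}" if "i < n" for i
    using cells_of_hole[OF \<omega>[unfolded cU] that] cells_of_hole[OF \<omega>'[unfolded cU'] that] eq
    unfolding cU cU' by simp
  have card_block: "card (cell (cs, U) ` {hole_start cs i..<hole_start cs (Suc i)}) = cs ! i"
    if "(cs, U) \<in> layouts n d m" "i < n" for cs U i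
  proof -
    have "{hole_start cs i..<hole_start cs (Suc i)} \<subseteq> {..<d}"
      using hole_start_le[of cs "Suc i"] layoutsD(2)[OF that(1)] by auto
    then have "inj_on (cell (cs, U)) {hole_start cs i..<hole_start cs (Suc i)}"
      using inj_on_cell[OF that(1)] inj_on_subset by blast
    then show ?thesis using hole_start_Suc[of i cs] layoutsD(1)[OF that(1)] that(2) by (simp add: card_image)
  qed
  have cs: "cs' = cs"
  proof (rule nth_equalityI)
    fix i assume "i < length cs'"
    then have "i < n" using L' by simp
    then show "cs' ! i = cs ! i"
      using card_block[OF \<omega>[unfolded cU], of i] card_block[OF \<omega>'[unfolded cU'], of i] block by simp
  qed (use L L' in simp)
  have "\<forall>t \<le> hole_start cs i. mark U t = mark U' t" if "i \<le> n" for i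
    using that
  proof (induction i)
    case 0
    then show ?case using mark_0[OF L(3,4)] mark_0[OF L'(3,4)] by simp
  next
    case (Suc i)
    then have IH: "\<And>t. t \<le> hole_start cs i \<Longrightarrow> mark U t = mark U' t" and i: "i < n" by auto
    let ?a = "hole_start cs i" and ?b = "hole_start cs (Suc i)"
    have b: "?b \<le> d" using hole_start_le[of cs "Suc i"] L(2) by simp
    have hole: "hole_of cs j = i" if "j \<in> {?a..<?b}" for j using hole_of_eqI[of cs i j] that by simp
    have "(\<lambda>j. mark U (Suc j) - mark U ?a) ` {?a..<?b} = snd ` cell (cs, U) ` {?a..<?b}"
      unfolding image_image by (intro image_cong) (auto simp: cell_def hole)
    also have "\<dots> = snd ` cell (cs, U') ` {?a..<?b}" using block[OF i] unfolding cs by simp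
    also have "\<dots> = (\<lambda>j. mark U' (Suc j) - mark U' ?a) ` {?a..<?b}"
      unfolding image_image by (intro image_cong) (auto simp: cell_def hole)
    finally have img: "(\<lambda>j. mark U (Suc j) - mark U ?a) ` {?a..<?b} = (\<lambda>j. mark U' (Suc j) - mark U' ?a) ` {?a..<?b}" .
    have incr: "mark U (Suc i') - mark U ?a < mark U (Suc j) - mark U ?a"
      if "U \<subseteq> {1..m}" "card U = d" "?a \<le> i'" "i' < j" "j < ?b" for U i' j
    proof -
      have "mark U (Suc i') < mark U (Suc j)"
        by (rule mark_strict_mono[OF that(1,2)]) (use that(4,5) b in linarith)+
      moreover have "mark U ?a < mark U (Suc i')"
        by (rule mark_strict_mono[OF that(1,2)]) (use that(3-5) b in linarith)+
      ultimately show ?thesis by linarith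
    qed
    have eq: "mark U (Suc j) - mark U ?a = mark U' (Suc j) - mark U' ?a" if "?a \<le> j" "j < ?b" for j
    proof (rule strict_mono_image_unique[where a = ?a and b = ?b and f = "\<lambda>j. mark U (Suc j) - mark U ?a"
            and g = "\<lambda>j. mark U' (Suc j) - mark U' ?a"])
      fix i j assume "?a \<le> i" "i < j" "j < ?b"
      then show "mark U (Suc i) - mark U ?a < mark U (Suc j) - mark U ?a"
        "mark U' (Suc i) - mark U' ?a < mark U' (Suc j) - mark U' ?a"
        by (rule incr[OF L(3,4)], rule incr[OF L'(3,4)])
    qed (fact img that)+
    show ?case
    proof (intro allI impI)
      fix t assume t: "t \<le> ?b"
      show "mark U t = mark U' t"
      proof (cases "t \<le> ?a")
        case False
        then obtain j where j: "t = Suc j" "?a \<le> j" "j < ?b" using t by (cases t) auto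
        then have "mark U ?a < mark U (Suc j)" "mark U' ?a < mark U' (Suc j)"
          using mark_strict_mono[OF L(3,4)] mark_strict_mono[OF L'(3,4)] b by auto
        then show ?thesis using eq[OF j(2,3)] IH[OF order_refl] j(1) by simp
      qed (use IH in simp)
    qed
  qed
  from this[of n] have "mark U t = mark U' t" if "t \<le> d" for t
    using that hole_start_length[of cs] L(1,2) by simp
  then have "(\<lambda>j. mark U (Suc j)) ` {..<d} = (\<lambda>j. mark U' (Suc j)) ` {..<d}"
    by (intro image_cong) auto
  then have "U = U'" using image_mark[OF L(3,4)] image_mark[OF L'(3,4)] by simp
  then show "\<omega> = \<omega>'" using cs cU cU' by simp
qed

section \<open>Counting the configurations won by a strategy\<close>

definition crossed :: "nat \<Rightarrow> dig_path \<Rightarrow> real \<Rightarrow> nat \<times> nat \<Rightarrow> bool" where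
  "crossed m x s c \<longleftrightarrow> real (snd c) \<le> real m * x s (fst c)"

definition cross_time :: "nat \<Rightarrow> nat \<Rightarrow> dig_path \<Rightarrow> nat \<times> nat \<Rightarrow> real" where
  "cross_time k m x c = Inf {s \<in> {0..real k}. crossed m x s c}"

definition dug_cells :: "nat \<Rightarrow> nat \<Rightarrow> nat \<Rightarrow> dig_path \<Rightarrow> (nat \<times> nat) set" where
  "dug_cells n k m x = {c. fst c < n \<and> 1 \<le> snd c \<and> crossed m x (real k) c}"

text \<open>Its cardinality is the rank of \<open>c\<close> in the order of digging.
  \<open>prod_encode\<close> breaks ties between cells finished simultaneously, so that ranks are
  distinct; the rank depends only on the path up to the crossing time of \<open>c\<close>.\<close>

definition dug_up_to :: "nat \<Rightarrow> nat \<Rightarrow> nat \<Rightarrow> dig_path \<Rightarrow> nat \<times> nat \<Rightarrow> (nat \<times> nat) set" where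
  "dug_up_to n k m x c = {c' \<in> dug_cells n k m x. cross_time k m x c' < cross_time k m x c \<or>
     cross_time k m x c' = cross_time k m x c \<and> prod_encode c' \<le> prod_encode c}"

section \<open>Crossing times and ranks of cells along a path\<close>

lemma valid_path_lipschitz:
  assumes "valid_path n k x" "i < n" "0 \<le> s" "s \<le> s'" "s' \<le> real k"
  shows "x s' i \<le> x s i + (s' - s)"
proof -
  have "x s' i - x s i \<le> (\<Sum>i<n. x s' i - x s i)"
    using assms unfolding valid_path_def by (intro member_le_sum) auto
  also have "\<dots> = s' - s" using assms unfolding valid_path_def by (simp add: sum_subtractf)
  finally show ?thesis by simp
qed

lemma crossed_mono:
  assumes "valid_path n k x" "fst c < n" "0 \<le> s" "s \<le> s'" "s' \<le> real k" "crossed m x s c"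
  shows "crossed m x s' c"
proof -
  have "x s (fst c) \<le> x s' (fst c)" using assms(1-5) unfolding valid_path_def by simp
  then have "real m * x s (fst c) \<le> real m * x s' (fst c)" by (simp add: mult_left_mono)
  then show ?thesis using assms(6) unfolding crossed_def by linarith
qed

lemma cross_time_bounds:
  assumes "c \<in> dug_cells n k m x"
  shows "0 \<le> cross_time k m x c" "cross_time k m x c \<le> real k"
proof -
  let ?A = "{s \<in> {0..real k}. crossed m x s c}"
  have k: "real k \<in> ?A" using assms unfolding dug_cells_def by simp
  then show "0 \<le> cross_time k m x c" unfolding cross_time_def by (intro cInf_greatest) auto
  show "cross_time k m x c \<le> real k" unfolding cross_time_def using k by (rule cInf_lower) (auto intro: bdd_belowI[of _ 0])
qed

text \<open>The infimum in \<open>cross_time\<close> is attained because each coordinate of a valid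
  path is 1-Lipschitz.\<close>

lemma crossed_iff_cross_time_le:
  assumes x: "valid_path n k x" and c: "c \<in> dug_cells n k m x" and s: "0 \<le> s" "s \<le> real k"
  shows "crossed m x s c \<longleftrightarrow> cross_time k m x c \<le> s"
proof
  let ?A = "{s \<in> {0..real k}. crossed m x s c}" and ?T = "cross_time k m x c"
  have A: "?A \<noteq> {}" "bdd_below ?A" using c unfolding dug_cells_def by (auto intro: bdd_belowI[of _ 0])
  assume "crossed m x s c"
  then show "?T \<le> s" unfolding cross_time_def using s A(2) by (intro cInf_lower) auto
next
  let ?A = "{s \<in> {0..real k}. crossed m x s c}" and ?T = "cross_time k m x c"
  have A: "?A \<noteq> {}" "bdd_below ?A" using c unfolding dug_cells_def by (auto intro: bdd_belowI[of _ 0])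
  note T = cross_time_bounds[OF c]
  have cn: "fst c < n" using c unfolding dug_cells_def by simp
  assume Ts: "?T \<le> s"
  have "real (snd c) \<le> real m * x ?T (fst c) + e" if "0 < e" for e
  proof -
    \<comment> \<open>The denominator is positive even for \<open>m = 0\<close>, and m/(m+1) is at
      most 1, so the error stays below \<open>e\<close>.\<close>
    have "?T < ?T + e / (real m + 1)" using that by simp
    then obtain r where r: "r \<in> ?A" "r < ?T + e / (real m + 1)"
      using cInf_lessD[OF A(1)] unfolding cross_time_def by blast
    have "?T \<le> r" unfolding cross_time_def using r(1) A(2) by (rule cInf_lower)
    then have "x r (fst c) \<le> x ?T (fst c) + (r - ?T)"
      using valid_path_lipschitz[OF x cn T(1)] r(1) by simp
    also have "\<dots> \<le> x ?T (fst c) + e / (real m + 1)" using r(2) by simp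
    finally have "real m * x r (fst c) \<le> real m * (x ?T (fst c) + e / (real m + 1))"
      by (simp add: mult_left_mono)
    also have "\<dots> \<le> real m * x ?T (fst c) + e" using that by (simp add: field_simps)
    finally show ?thesis using r(1) unfolding crossed_def by simp
  qed
  then have "crossed m x ?T c" unfolding crossed_def by (rule field_le_epsilon)
  with crossed_mono[OF x cn T(1) Ts s(2)] show "crossed m x s c" by blast
qed

lemma dug_cells_bound:
  assumes "valid_path n k x"
  shows "finite (dug_cells n k m x)" "card (dug_cells n k m x) \<le> m * k"
proof -
  let ?S = "SIGMA i:{..<n}. {1..nat \<lfloor>real m * x (real k) i\<rfloor>}"
  have sub: "dug_cells n k m x \<subseteq> ?S"
    unfolding dug_cells_def crossed_def by (auto simp: le_nat_floor)
  have fin: "finite ?S" by auto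
  show "finite (dug_cells n k m x)" using finite_subset[OF sub fin] .
  have "real (card ?S) = (\<Sum>i<n. real (nat \<lfloor>real m * x (real k) i\<rfloor>))" by simp
  also have "\<dots> \<le> (\<Sum>i<n. real m * x (real k) i)"
  proof (rule sum_mono)
    fix i assume "i \<in> {..<n}"
    then have "0 \<le> real m * x (real k) i" using assms unfolding valid_path_def by simp
    then show "real (nat \<lfloor>real m * x (real k) i\<rfloor>) \<le> real m * x (real k) i" by (rule of_nat_floor)
  qed
  also have "\<dots> = real (m * k)"
    using assms unfolding valid_path_def by (simp add: sum_distrib_left[symmetric])
  finally have "card ?S \<le> m * k" by (simp only: of_nat_le_iff)
  then show "card (dug_cells n k m x) \<le> m * k" using card_mono[OF fin sub] by linarith
qed

lemma card_dug_up_to_range: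
  assumes "valid_path n k x" "c \<in> dug_cells n k m x"
  shows "card (dug_up_to n k m x c) \<in> {1..m * k}"
proof -
  have sub: "dug_up_to n k m x c \<subseteq> dug_cells n k m x" unfolding dug_up_to_def by auto
  have "c \<in> dug_up_to n k m x c" using assms(2) unfolding dug_up_to_def by simp
  moreover have fin: "finite (dug_up_to n k m x c)" using finite_subset[OF sub dug_cells_bound(1)[OF assms(1)]] .
  ultimately have "0 < card (dug_up_to n k m x c)" by (auto simp: card_gt_0_iff)
  moreover have "card (dug_up_to n k m x c) \<le> m * k"
    using card_mono[OF dug_cells_bound(1)[OF assms(1)] sub] dug_cells_bound(2)[OF assms(1), of m] by linarith
  ultimately show ?thesis by simp
qed

lemma inj_on_card_dug_up_to:
  assumes "valid_path n k x"
  shows "inj_on (\<lambda>c. card (dug_up_to n k m x c)) (dug_cells n k m x)"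
proof -
  have fin: "finite (dug_up_to n k m x c)" for c
    by (rule finite_subset[OF _ dug_cells_bound(1)[OF assms]]) (auto simp: dug_up_to_def)
  have less: "card (dug_up_to n k m x c) < card (dug_up_to n k m x c')"
    if "c' \<in> dug_cells n k m x" "cross_time k m x c < cross_time k m x c' \<or>
      cross_time k m x c = cross_time k m x c' \<and> prod_encode c < prod_encode c'" for c c'
  proof (rule psubset_card_mono[OF fin])
    have "c' \<in> dug_up_to n k m x c'" "c' \<notin> dug_up_to n k m x c"
      using that unfolding dug_up_to_def by auto
    moreover have "dug_up_to n k m x c \<subseteq> dug_up_to n k m x c'"
      using that(2) unfolding dug_up_to_def by auto
    ultimately show "dug_up_to n k m x c \<subset> dug_up_to n k m x c'" by blast
  qed
  show ?thesis
  proof (rule inj_onI, rule ccontr)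
    fix c c' assume *: "c \<in> dug_cells n k m x" "c' \<in> dug_cells n k m x"
      "card (dug_up_to n k m x c) = card (dug_up_to n k m x c')" "c \<noteq> c'"
    then have "prod_encode c \<noteq> prod_encode c'" by simp
    then consider "cross_time k m x c < cross_time k m x c' \<or>
        cross_time k m x c = cross_time k m x c' \<and> prod_encode c < prod_encode c'"
      | "cross_time k m x c' < cross_time k m x c \<or>
        cross_time k m x c' = cross_time k m x c \<and> prod_encode c' < prod_encode c"
      by linarith
    then show False using less[of c' c] less[of c c'] * by cases auto
  qed
qed

text \<open>Crossing times up to \<open>s\<close> are decided by the common initial part of the two
  paths. Inclusion suffices, as the converse follows by exchanging the paths.\<close>

lemma dug_up_to_subset:
  assumes x: "valid_path n k x" and x': "valid_path n k x'"
    and s: "0 \<le> s" "s \<le> real k" and agree: "\<And>r. 0 \<le> r \<Longrightarrow> r \<le> s \<Longrightarrow> x r = x' r"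
  shows dug_cells_agree: "\<And>c. c \<in> dug_cells n k m x \<Longrightarrow> cross_time k m x c \<le> s \<Longrightarrow>
      c \<in> dug_cells n k m x' \<and> cross_time k m x' c = cross_time k m x c"
    and "\<And>c. c \<in> dug_cells n k m x \<Longrightarrow> cross_time k m x c \<le> s \<Longrightarrow>
      dug_up_to n k m x c \<subseteq> dug_up_to n k m x' c"
proof -
  show 1: "c \<in> dug_cells n k m x' \<and> cross_time k m x' c = cross_time k m x c"
    if c: "c \<in> dug_cells n k m x" "cross_time k m x c \<le> s" for c
  proof -
    let ?t = "cross_time k m x c"
    note t = cross_time_bounds[OF c(1)]
    have cn: "fst c < n" "1 \<le> snd c" using c(1) unfolding dug_cells_def by auto
    have "crossed m x ?t c" using crossed_iff_cross_time_le[OF x c(1) t] by simp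
    then have cr: "crossed m x' ?t c" using agree[OF t(1) c(2)] unfolding crossed_def by simp
    then have "crossed m x' (real k) c" using crossed_mono[OF x' cn(1) t(1) t(2)] by simp
    then have c': "c \<in> dug_cells n k m x'" using cn unfolding dug_cells_def by simp
    note t' = cross_time_bounds[OF c']
    have le: "cross_time k m x' c \<le> ?t" using crossed_iff_cross_time_le[OF x' c' t] cr by simp
    have "crossed m x' (cross_time k m x' c) c" using crossed_iff_cross_time_le[OF x' c' t'] by simp
    then have "crossed m x (cross_time k m x' c) c"
      using agree[OF t'(1)] le c(2) unfolding crossed_def by simp
    then have "?t \<le> cross_time k m x' c" using crossed_iff_cross_time_le[OF x c(1) t'] by simp
    with le c' show ?thesis by simp
  qed
  show "dug_up_to n k m x c \<subseteq> dug_up_to n k m x' c"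
    if c: "c \<in> dug_cells n k m x" "cross_time k m x c \<le> s" for c
  proof
    fix c' assume c': "c' \<in> dug_up_to n k m x c"
    then have "c' \<in> dug_cells n k m x" "cross_time k m x c' \<le> s" using c unfolding dug_up_to_def by auto
    from 1[OF this] 1[OF c] c' show "c' \<in> dug_up_to n k m x' c" unfolding dug_up_to_def by simp
  qed
qed

lemma dug_up_to_agree:
  assumes x: "valid_path n k x" and x': "valid_path n k x'"
    and s: "0 \<le> s" "s \<le> real k" and agree: "\<And>r. 0 \<le> r \<Longrightarrow> r \<le> s \<Longrightarrow> x r = x' r"
    and c: "c \<in> dug_cells n k m x" "cross_time k m x c \<le> s"
  shows "dug_up_to n k m x c = dug_up_to n k m x' c"
proof
  show "dug_up_to n k m x c \<subseteq> dug_up_to n k m x' c" by (rule dug_up_to_subset[OF x x' s agree c])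
  have agree': "x' r = x r" if "0 \<le> r" "r \<le> s" for r using agree[OF that] by simp
  show "dug_up_to n k m x' c \<subseteq> dug_up_to n k m x c"
    by (rule dug_up_to_subset[OF x' x s agree']) (use dug_cells_agree[OF x x' s agree c] c(2) in auto)
qed

text \<open>A cell crossed by time \<open>s\<close> has the same rank along both paths. That rank
  belongs to some cell of \<open>G'\<close>, and injectivity of ranks along \<open>x'\<close>
  identifies the two cells.\<close>

lemma cells_crossed_agree:
  assumes x: "valid_path n k x" and x': "valid_path n k x'"
    and s: "0 \<le> s" "s \<le> real k" and agree: "\<And>r. 0 \<le> r \<Longrightarrow> r \<le> s \<Longrightarrow> x r = x' r"
    and G: "G \<subseteq> dug_cells n k m x" "G' \<subseteq> dug_cells n k m x'"
    and ranks: "(\<lambda>c. card (dug_up_to n k m x c)) ` G = (\<lambda>c. card (dug_up_to n k m x' c)) ` G'"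
  shows "{c \<in> G. crossed m x s c} \<subseteq> {c \<in> G'. crossed m x' s c}"
proof clarify
  fix i a assume "(i, a) \<in> G" "crossed m x s (i, a)"
  then obtain c where c_def: "c = (i, a)" and c: "c \<in> G" "crossed m x s c" by blast
  have cd: "c \<in> dug_cells n k m x" using c G by auto
  have t: "cross_time k m x c \<le> s" using c(2) crossed_iff_cross_time_le[OF x cd s] by simp
  have cd': "c \<in> dug_cells n k m x'" using dug_cells_agree[OF x x' s agree cd t] by simp
  have "card (dug_up_to n k m x c) \<in> (\<lambda>c. card (dug_up_to n k m x' c)) ` G'"
    unfolding ranks[symmetric] using c(1) by blast
  then obtain c' where c': "c' \<in> G'" "card (dug_up_to n k m x' c) = card (dug_up_to n k m x' c')"
    using dug_up_to_agree[OF x x' s agree cd t] by auto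
  then have "c = c'" using inj_on_card_dug_up_to[OF x', of m] cd' G(2) by (auto dest: inj_onD)
  moreover have "crossed m x' s c" using c(2) agree[OF s(1)] unfolding crossed_def by simp
  ultimately show "(i, a) \<in> G' \<and> crossed m x' s (i, a)" using c' c_def by simp
qed

text \<open>The two searches cannot separate: consider the infimum of the times at which the observations
  differ. Up to it the paths agree, hence so do the ranks, hence so do the treasures found.\<close>

lemma same_ranks_imp_same_cells:
  assumes x: "valid_path n k x" and x': "valid_path n k x'"
    and fin: "finite G" "finite G'"
    and nonant: "\<And>s. 0 \<le> s \<Longrightarrow> s \<le> real k \<Longrightarrow>
      (\<And>r. 0 \<le> r \<Longrightarrow> r < s \<Longrightarrow> {c \<in> G. crossed m x r c} = {c \<in> G'. crossed m x' r c}) \<Longrightarrow>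
      (\<And>r. 0 \<le> r \<Longrightarrow> r \<le> s \<Longrightarrow> x r = x' r)"
    and G: "G \<subseteq> dug_cells n k m x" "G' \<subseteq> dug_cells n k m x'"
    and ranks: "(\<lambda>c. card (dug_up_to n k m x c)) ` G = (\<lambda>c. card (dug_up_to n k m x' c)) ` G'"
  shows "G = G'"
proof -
  define O1 where "O1 r = {c \<in> G. crossed m x r c}" for r
  define O2 where "O2 r = {c \<in> G'. crossed m x' r c}" for r
  define D where "D = {r \<in> {0..real k}. O1 r \<noteq> O2 r}"
  have "D = {}"
  proof (rule ccontr)
    assume D: "D \<noteq> {}"
    have bdd: "bdd_below D" unfolding D_def by (auto intro: bdd_belowI[of _ 0])
    define s where "s = Inf D"
    have s_le: "s \<le> r" if "r \<in> D" for r unfolding s_def using that bdd by (rule cInf_lower)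
    have s0: "0 \<le> s" unfolding s_def using D by (intro cInf_greatest) (auto simp: D_def)
    have sk: "s \<le> real k" using D s_le unfolding D_def by force
    have eq_before: "O1 r = O2 r" if "0 \<le> r" "r < s" for r
      using that s_le[of r] sk unfolding D_def by force
    have agree: "x r = x' r" if "0 \<le> r" "r \<le> s" for r
      using nonant[OF s0 sk _ that] eq_before unfolding O1_def O2_def by blast
    then have agree': "x' r = x r" if "0 \<le> r" "r \<le> s" for r using that by simp
    have eq_s: "O1 s = O2 s"
      unfolding O1_def O2_def
      using cells_crossed_agree[OF x x' s0 sk agree G ranks]
        cells_crossed_agree[OF x' x s0 sk agree' G(2,1) ranks[symmetric]] by (intro subset_antisym)
    \<comment> \<open>The next crossing time of a treasure cell after \<open>s\<close>, with
      \<open>s + 1\<close> as a default when there is none. Up to \<open>e\<close> nothing new is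
      found, so no times of \<open>D\<close> can approach \<open>s\<close> from above.\<close>
    define e where "e = Min (insert (s + 1) {t \<in> cross_time k m x ` G \<union> cross_time k m x' ` G'. s < t})"
    have fin_e: "finite (insert (s + 1) {t \<in> cross_time k m x ` G \<union> cross_time k m x' ` G'. s < t})"
      using fin by simp
    have "s < e" unfolding e_def using fin_e by (subst Min_gr_iff) auto
    then obtain r where r: "r \<in> D" "r < e"
      using cInf_lessD[OF D, of e] unfolding s_def by blast
    have rb: "0 \<le> r" "r \<le> real k" "s \<le> r" using r(1) s_le unfolding D_def by auto
    have no: "\<not> (s < t \<and> t \<le> r)" if "t \<in> cross_time k m x ` G \<union> cross_time k m x' ` G'" for t
    proof
      assume "s < t \<and> t \<le> r"
      then have "e \<le> t" unfolding e_def using that fin_e by (intro Min_le) auto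
      then show False using r(2) \<open>s < t \<and> t \<le> r\<close> by simp
    qed
    have still: "crossed m y r c \<longleftrightarrow> crossed m y s c"
      if y: "valid_path n k y" "c \<in> dug_cells n k m y" and n: "\<not> (s < cross_time k m y c \<and> cross_time k m y c \<le> r)" for y c
      using crossed_iff_cross_time_le[OF y rb(1,2)] crossed_iff_cross_time_le[OF y s0 sk] n rb(3) by auto
    have "O1 r = O1 s" unfolding O1_def using still[OF x] G(1) no by blast
    moreover have "O2 r = O2 s" unfolding O2_def using still[OF x'] G(2) no by blast
    ultimately show False using eq_s r(1) unfolding D_def by simp
  qed
  then have "O1 (real k) = O2 (real k)" unfolding D_def by auto
  moreover have "O1 (real k) = G" "O2 (real k) = G'"
    using G unfolding O1_def O2_def dug_cells_def by auto
  ultimately show ?thesis by simp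
qed

section \<open>Layouts won by a pure strategy\<close>

lemma snd_grid_config: "snd (grid_config m \<omega>) = (\<lambda>j. cell_position m (cell \<omega> j))"
  unfolding grid_config_def by (cases \<omega>) simp

lemma found_grid_config:
  assumes "0 < m"
  shows "found x (grid_config m \<omega>) s j \<longleftrightarrow> crossed m x s (cell \<omega> j)"
  using assms unfolding found_def snd_grid_config crossed_def cell_position_def by (simp add: field_simps)

lemma observation_grid_config:
  assumes "\<omega> \<in> layouts n d m" "0 < m"
  shows "observation d x (grid_config m \<omega>) s =
    image_mset (cell_position m) (mset_set {c \<in> cell \<omega> ` {..<d}. crossed m x s c})"
proof -
  obtain cs U where \<omega>: "\<omega> = (cs, U)" by (cases \<omega>)
  have inj: "inj_on (cell \<omega>) {j \<in> {..<d}. crossed m x s (cell \<omega> j)}"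
    using inj_on_cell[OF assms(1)[unfolded \<omega>]] unfolding \<omega> by (rule inj_on_subset) auto
  have img: "{c \<in> cell \<omega> ` {..<d}. crossed m x s c} = cell \<omega> ` {j \<in> {..<d}. crossed m x s (cell \<omega> j)}"
    by blast
  have "observation d x (grid_config m \<omega>) s =
      image_mset (\<lambda>j. cell_position m (cell \<omega> j)) (mset_set {j \<in> {..<d}. crossed m x s (cell \<omega> j)})"
    unfolding observation_def by (simp add: found_grid_config[OF assms(2)] snd_grid_config)
  also have "\<dots> = image_mset (cell_position m) (mset_set (cell \<omega> ` {j \<in> {..<d}. crossed m x s (cell \<omega> j)}))"
    unfolding image_mset_mset_set[OF inj, symmetric] by (simp add: image_mset.compositionality comp_def)
  finally show ?thesis unfolding img .
qed

lemma searcher_strategiesD: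
  assumes "\<sigma> \<in> searcher_strategies n d k" "valid_config n d C" "valid_config n d C'" "s \<in> {0..real k}"
    and "\<forall>r\<in>{0..<s}. observation d (\<sigma> C) C r = observation d (\<sigma> C') C' r" "r \<in> {0..s}"
  shows "\<sigma> C r = \<sigma> C' r"
  using assms unfolding searcher_strategies_def by blast

text \<open>Ranks are taken along the path that the strategy follows against that very layout. The
  rank set determines the cells, the cells determine the layout, and winning means that all
  \<open>d\<close> cells have ranks in \<open>{1..m * k}\<close>.\<close>

lemma card_winning_layouts_le:
  assumes \<sigma>: "\<sigma> \<in> searcher_strategies n d k" and m: "0 < m"
  shows "card {\<omega> \<in> layouts n d m. searcher_wins d k \<sigma> (grid_config m \<omega>)} \<le> (m * k) choose d"
proof -
  let ?W = "{\<omega> \<in> layouts n d m. searcher_wins d k \<sigma> (grid_config m \<omega>)}"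
  let ?x = "\<lambda>\<omega>. \<sigma> (grid_config m \<omega>)"
  let ?f = "\<lambda>\<omega>. (\<lambda>c. card (dug_up_to n k m (?x \<omega>) c)) ` cell \<omega> ` {..<d}"
  have path: "valid_path n k (?x \<omega>)" if "\<omega> \<in> layouts n d m" for \<omega>
    using \<sigma> valid_grid_config[OF that m] unfolding searcher_strategies_def by blast
  have dug: "cell \<omega> ` {..<d} \<subseteq> dug_cells n k m (?x \<omega>)" if "\<omega> \<in> ?W" for \<omega>
  proof -
    obtain cs U where \<omega>: "\<omega> = (cs, U)" by (cases \<omega>)
    then have L: "(cs, U) \<in> layouts n d m" using that by simp
    show ?thesis
      using that cell_props(1,2)[OF L] found_grid_config[OF m]
      unfolding dug_cells_def searcher_wins_def \<omega> by fastforce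
  qed
  have "inj_on ?f ?W"
  proof (rule inj_onI)
    fix \<omega> \<omega>' assume W: "\<omega> \<in> ?W" "\<omega>' \<in> ?W" and eq: "?f \<omega> = ?f \<omega>'"
    then have L: "\<omega> \<in> layouts n d m" "\<omega>' \<in> layouts n d m" by auto
    have "cell \<omega> ` {..<d} = cell \<omega>' ` {..<d}"
    proof (rule same_ranks_imp_same_cells[OF path[OF L(1)] path[OF L(2)] _ _ _ dug[OF W(1)] dug[OF W(2)] eq])
      fix s r assume s: "0 \<le> s" "s \<le> real k" and r: "0 \<le> r" "r \<le> s"
        and obs: "\<And>r. 0 \<le> r \<Longrightarrow> r < s \<Longrightarrow>
          {c \<in> cell \<omega> ` {..<d}. crossed m (?x \<omega>) r c} = {c \<in> cell \<omega>' ` {..<d}. crossed m (?x \<omega>') r c}"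
      have "\<forall>r\<in>{0..<s}. observation d (?x \<omega>) (grid_config m \<omega>) r = observation d (?x \<omega>') (grid_config m \<omega>') r"
        using obs unfolding observation_grid_config[OF L(1) m] observation_grid_config[OF L(2) m] by simp
      then show "?x \<omega> r = ?x \<omega>' r"
        using searcher_strategiesD[OF \<sigma> valid_grid_config[OF L(1) m] valid_grid_config[OF L(2) m], of s] s r by simp
    qed auto
    then show "\<omega> = \<omega>'" using L by (rule inj_onD[OF inj_on_cells])
  qed
  moreover have "?f ` ?W \<subseteq> {A. A \<subseteq> {1..m * k} \<and> card A = d}"
  proof (intro subsetI, elim imageE, simp only: mem_Collect_eq, intro conjI)
    fix A \<omega> assume "\<omega> \<in> layouts n d m \<and> searcher_wins d k \<sigma> (grid_config m \<omega>)"
    then have W: "\<omega> \<in> ?W" and L: "\<omega> \<in> layouts n d m" by auto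
    show "?f \<omega> \<subseteq> {1..m * k}" using card_dug_up_to_range[OF path[OF L]] dug[OF W] by blast
    have "card (?f \<omega>) = card (cell \<omega> ` {..<d})"
      using inj_on_card_dug_up_to[OF path[OF L]] dug[OF W] by (intro card_image) (rule inj_on_subset)
    also have "\<dots> = d" using inj_on_cell[of "fst \<omega>" "snd \<omega>" n d m] L by (simp add: card_image)
    finally show "card (?f \<omega>) = d" .
  qed
  moreover have "finite {A. A \<subseteq> {1..m * k} \<and> card A = d}"
    by (rule finite_subset[of _ "Pow {1..m * k}"]) auto
  ultimately have "card ?W \<le> card {A. A \<subseteq> {1..m * k} \<and> card A = d}" by (rule card_inj_on_le)
  then show ?thesis by (simp add: n_subsets)
qed

section \<open>The value of the game\<close>

text \<open>The double counting used for both players: a finite family on one side, an arbitrary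
  \<open>pmf\<close> on the other.\<close>

lemma sum_prob_eq_expectation_card:
  fixes q :: "'b pmf"
  assumes "finite A"
  shows "(\<Sum>a\<in>A. measure_pmf.prob q {y. R a y}) = measure_pmf.expectation q (\<lambda>y. real (card {a \<in> A. R a y}))"
proof -
  have "(\<Sum>a\<in>A. measure_pmf.prob q {y. R a y}) = (\<Sum>a\<in>A. measure_pmf.expectation q (indicator {y. R a y}))"
    by simp
  also have "\<dots> = measure_pmf.expectation q (\<lambda>y. \<Sum>a\<in>A. indicator {y. R a y} y)"
    by (intro Bochner_Integration.integral_sum[symmetric]) (auto intro!: integrable_real_indicator simp: less_top[symmetric])
  also have "\<dots> = measure_pmf.expectation q (\<lambda>y. real (card {a \<in> A. R a y}))"
    using assms by (intro Bochner_Integration.integral_cong refl) (simp add: indicator_def sum.If_cases Int_def)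
  finally show ?thesis .
qed

lemma integrable_card: "finite A \<Longrightarrow> integrable (measure_pmf q) (\<lambda>y. real (card {a \<in> A. R a y}))"
  by (rule measure_pmf.integrable_const_bound[where B = "real (card A)"]) (auto intro!: card_mono)

lemma card_layouts_pos: "0 < n \<Longrightarrow> d \<le> m \<Longrightarrow> 0 < card (layouts n d m)"
  unfolding card_layouts by simp

text \<open>A worst case is at most the average over the layouts, which the counting bound controls
  for every mixed searcher. Boundedness is recorded because a real \<open>Sup\<close> dominates its
  elements only for bounded sets.\<close>

lemma lower_value_le_layouts:
  assumes "0 < m" "d \<le> m" "0 < n" "searcher_strategies n d k \<noteq> {}"
  shows "lower_value n d k \<le> real ((m * k) choose d) / real (card (layouts n d m))"
    and "bdd_above {Inf {measure_pmf.prob p {\<sigma>. searcher_wins d k \<sigma> C} | C. valid_config n d C}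
                           | p. set_pmf p \<subseteq> searcher_strategies n d k}"
proof -
  let ?b = "real ((m * k) choose d) / real (card (layouts n d m))"
  have L0: "0 < card (layouts n d m)" using card_layouts_pos[OF assms(3,2)] .
  have le: "Inf {measure_pmf.prob p {\<sigma>. searcher_wins d k \<sigma> C} | C. valid_config n d C} \<le> ?b"
    if p: "set_pmf p \<subseteq> searcher_strategies n d k" for p
  proof -
    have "(\<Sum>\<omega>\<in>layouts n d m. measure_pmf.prob p {\<sigma>. searcher_wins d k \<sigma> (grid_config m \<omega>)}) =
        measure_pmf.expectation p (\<lambda>\<sigma>. real (card {\<omega> \<in> layouts n d m. searcher_wins d k \<sigma> (grid_config m \<omega>)}))"
      by (rule sum_prob_eq_expectation_card[OF finite_layouts])
    also have "\<dots> \<le> real ((m * k) choose d)"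
    proof (rule measure_pmf.integral_le_const[OF integrable_card[OF finite_layouts]])
      show "AE \<sigma> in measure_pmf p. real (card {\<omega> \<in> layouts n d m. searcher_wins d k \<sigma> (grid_config m \<omega>)}) \<le> real ((m * k) choose d)"
        unfolding AE_measure_pmf_iff of_nat_le_iff using p card_winning_layouts_le[OF _ assms(1)] by blast
    qed
    finally have sum: "(\<Sum>\<omega>\<in>layouts n d m. measure_pmf.prob p {\<sigma>. searcher_wins d k \<sigma> (grid_config m \<omega>)}) \<le> real ((m * k) choose d)" .
    have "real (card (layouts n d m)) * Inf {measure_pmf.prob p {\<sigma>. searcher_wins d k \<sigma> C} | C. valid_config n d C}
        \<le> (\<Sum>\<omega>\<in>layouts n d m. measure_pmf.prob p {\<sigma>. searcher_wins d k \<sigma> (grid_config m \<omega>)})"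
    proof (rule sum_bounded_below)
      fix \<omega> assume "\<omega> \<in> layouts n d m"
      then have "valid_config n d (grid_config m \<omega>)" using valid_grid_config assms(1) by blast
      then show "Inf {measure_pmf.prob p {\<sigma>. searcher_wins d k \<sigma> C} | C. valid_config n d C}
          \<le> measure_pmf.prob p {\<sigma>. searcher_wins d k \<sigma> (grid_config m \<omega>)}"
        by (intro cInf_lower) (blast, auto intro: bdd_belowI[of _ 0])
    qed
    with sum show ?thesis using L0 by (simp add: field_simps)
  qed
  then show "bdd_above {Inf {measure_pmf.prob p {\<sigma>. searcher_wins d k \<sigma> C} | C. valid_config n d C}
                           | p. set_pmf p \<subseteq> searcher_strategies n d k}"
    by (intro bdd_aboveI[of _ ?b]) blast
  obtain \<sigma> where "\<sigma> \<in> searcher_strategies n d k" using assms(4) by blast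
  then have "set_pmf (return_pmf \<sigma>) \<subseteq> searcher_strategies n d k" by simp
  then show "lower_value n d k \<le> ?b"
    unfolding lower_value_def using le by (intro cSup_least) blast+
qed

lemma upper_value_le_layouts:
  assumes "0 < m" "d \<le> m" "0 < n" "searcher_strategies n d k \<noteq> {}"
  shows "upper_value n d k \<le> real ((m * k) choose d) / real (card (layouts n d m))"
proof -
  let ?b = "real ((m * k) choose d) / real (card (layouts n d m))"
  have ne: "layouts n d m \<noteq> {}" using card_layouts_pos[OF assms(3,2)] by auto
  define q where "q = map_pmf (grid_config m) (pmf_of_set (layouts n d m))"
  have q: "set_pmf q \<subseteq> {C. valid_config n d C}"
    unfolding q_def using valid_grid_config[OF _ assms(1)] by (auto simp: set_pmf_of_set[OF ne finite_layouts])
  have prob: "measure_pmf.prob q {C. searcher_wins d k \<sigma> C} \<le> ?b" if "\<sigma> \<in> searcher_strategies n d k" for \<sigma>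
  proof -
    have "measure_pmf.prob q {C. searcher_wins d k \<sigma> C} =
        real (card {\<omega> \<in> layouts n d m. searcher_wins d k \<sigma> (grid_config m \<omega>)}) / real (card (layouts n d m))"
      unfolding q_def by (simp add: measure_pmf_of_set[OF ne finite_layouts] vimage_def Int_def)
    also have "\<dots> \<le> ?b"
      using card_winning_layouts_le[OF that assms(1)] by (intro divide_right_mono) auto
    finally show ?thesis .
  qed
  have "upper_value n d k \<le> Sup {measure_pmf.prob q {C. searcher_wins d k \<sigma> C} | \<sigma>. \<sigma> \<in> searcher_strategies n d k}"
    unfolding upper_value_def
  proof (rule cInf_lower)
    obtain \<sigma> where \<sigma>: "\<sigma> \<in> searcher_strategies n d k" using assms(4) by blast
    have "0 \<le> Sup {measure_pmf.prob q {C. searcher_wins d k \<sigma> C} | \<sigma>. \<sigma> \<in> searcher_strategies n d k}" for q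
      by (rule cSup_upper2[of "measure_pmf.prob q {C. searcher_wins d k \<sigma> C}"])
         (use \<sigma> in \<open>auto intro: bdd_aboveI[of _ 1]\<close>)
    then show "bdd_below {Sup {measure_pmf.prob q {C. searcher_wins d k \<sigma> C} | \<sigma>. \<sigma> \<in> searcher_strategies n d k}
                           | q. set_pmf q \<subseteq> {C. valid_config n d C}}"
      by (intro bdd_belowI[of _ 0]) blast
  qed (use q in blast)
  also have "\<dots> \<le> ?b" using assms(4) prob by (intro cSup_least) blast+
  finally show ?thesis .
qed

lemma layouts_bound_tendsto:
  "(\<lambda>m. real ((m * k) choose d) / real (card (layouts n d m))) \<longlonglongrightarrow> real k ^ d / real ((n + d - 1) choose d)"
proof -
  have "(\<lambda>m. \<Prod>i<d. (real m * real k - real i) / (real m - real i)) \<longlonglongrightarrow> (\<Prod>i<d. real k)"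
    by (intro tendsto_prod) real_asymp
  then have "(\<lambda>m. (\<Prod>i<d. (real m * real k - real i) / (real m - real i)) / real ((n + d - 1) choose d))
      \<longlonglongrightarrow> real k ^ d / real ((n + d - 1) choose d)"
    unfolding prod_constant card_lessThan divide_inverse by (rule tendsto_mult_right)
  \<comment> \<open>Valid for every \<open>m\<close>: below \<open>d\<close> both sides are 0, since
    the binomial coefficient vanishes on the left and the factor \<open>i = m\<close> on the right,
    both by division by zero.\<close>
  moreover have "real ((m * k) choose d) / real (card (layouts n d m)) =
      (\<Prod>i<d. (real m * real k - real i) / (real m - real i)) / real ((n + d - 1) choose d)" for m
    unfolding card_layouts of_nat_mult binomial_gbinomial gbinomial_prod_rev
    by (simp add: prod_dividef lessThan_atLeast0 field_simps)
  ultimately show ?thesis by simp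
qed

theorem theorem5:
  fixes d k :: nat
  assumes "0 < d" and "0 < k"
  shows "\<exists>N. \<forall>n\<ge>N.
           lower_value n d k = real k ^ d / real ((n + d - 1) choose d) \<and>
           upper_value n d k = real k ^ d / real ((n + d - 1) choose d)"
proof (intro exI[of _ "d * Suc k"] allI impI)
  \<comment> \<open>This size provides \<open>d\<close> disjoint blocks of \<open>k\<close> places,
    room for up to \<open>d\<close> places that a block has to avoid, and
    \<open>d * k \<le> n\<close>, so that all replacement thresholds are in range.\<close>
  fix n assume n: "d * Suc k \<le> n"
  let ?v = "real k ^ d / real ((n + d - 1) choose d)"
  obtain P :: "(nat set \<times> nat \<times> nat) list set" and \<sigma> where P: "finite P" "P \<noteq> {}"
    and \<sigma>: "\<sigma> ` P \<subseteq> searcher_strategies n d k"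
    and win: "\<And>C. valid_config n d C \<Longrightarrow> ?v * real (card P) \<le> real (card {p \<in> P. searcher_wins d k (\<sigma> p) C})"
    using searcher_guarantee[OF assms(2) n assms(1)] by blast
  have cP: "0 < card P" using P by (simp add: card_gt_0_iff)
  have ne: "searcher_strategies n d k \<noteq> {}" using P(2) \<sigma> by blast
  have n0: "0 < n" using n assms(1) by (cases n) auto
  have valid: "valid_config n d ((\<lambda>_. 0), (\<lambda>_. (0, 0)))" using n0 unfolding valid_config_def by simp

  have "?v \<le> lower_value n d k"
  proof -
    define p where "p = map_pmf \<sigma> (pmf_of_set P)"
    have p: "set_pmf p \<subseteq> searcher_strategies n d k"
      unfolding p_def using \<sigma> by (simp add: set_pmf_of_set[OF P(2,1)])
    have "?v \<le> measure_pmf.prob p {\<sigma>. searcher_wins d k \<sigma> C}" if "valid_config n d C" for C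
    proof -
      have "measure_pmf.prob p {\<sigma>. searcher_wins d k \<sigma> C} = real (card {p \<in> P. searcher_wins d k (\<sigma> p) C}) / real (card P)"
        unfolding p_def by (simp add: measure_pmf_of_set[OF P(2,1)] vimage_def Int_def)
      also have "?v \<le> \<dots>" using win[OF that] cP by (subst pos_le_divide_eq) auto
      finally show ?thesis .
    qed
    then have "?v \<le> Inf {measure_pmf.prob p {\<sigma>. searcher_wins d k \<sigma> C} | C. valid_config n d C}"
      using valid by (intro cInf_greatest) blast+
    also have "\<dots> \<le> lower_value n d k"
      unfolding lower_value_def
      using p lower_value_le_layouts(2)[OF assms(1) order_refl n0 ne] by (intro cSup_upper) blast+
    finally show ?thesis .
  qed

  moreover have "?v \<le> upper_value n d k"
    unfolding upper_value_def
  proof (rule cInf_greatest)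
    have "set_pmf (return_pmf ((\<lambda>_. 0), (\<lambda>_. (0, 0)))) \<subseteq> {C. valid_config n d C}" using valid by simp
    then show "{Sup {measure_pmf.prob q {C. searcher_wins d k \<sigma> C} | \<sigma>. \<sigma> \<in> searcher_strategies n d k}
        | q. set_pmf q \<subseteq> {C. valid_config n d C}} \<noteq> {}" by blast
    fix z assume "z \<in> {Sup {measure_pmf.prob q {C. searcher_wins d k \<sigma> C} | \<sigma>. \<sigma> \<in> searcher_strategies n d k}
        | q. set_pmf q \<subseteq> {C. valid_config n d C}}"
    then obtain q where z: "z = Sup {measure_pmf.prob q {C. searcher_wins d k \<sigma> C} | \<sigma>. \<sigma> \<in> searcher_strategies n d k}"
      and q: "set_pmf q \<subseteq> {C. valid_config n d C}" by blast
    \<comment> \<open>Against a fixed hider \<open>q\<close>, the best reply is at least as good as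
      the average over the plans, and that average is at least \<open>?v\<close> because each pure
      configuration loses to that share of them.\<close>
    have "?v * real (card P) \<le> measure_pmf.expectation q (\<lambda>C. real (card {p \<in> P. searcher_wins d k (\<sigma> p) C}))"
    proof (rule measure_pmf.integral_ge_const[OF integrable_card[OF P(1)]])
      show "AE C in measure_pmf q. ?v * real (card P) \<le> real (card {p \<in> P. searcher_wins d k (\<sigma> p) C})"
        unfolding AE_measure_pmf_iff using q win by blast
    qed
    also have "\<dots> = (\<Sum>p\<in>P. measure_pmf.prob q {C. searcher_wins d k (\<sigma> p) C})"
      by (rule sum_prob_eq_expectation_card[OF P(1), symmetric])
    also have "\<dots> \<le> (\<Sum>p\<in>P. z)"
    proof (rule sum_mono)
      fix p assume "p \<in> P"
      then show "measure_pmf.prob q {C. searcher_wins d k (\<sigma> p) C} \<le> z"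
        unfolding z using \<sigma> by (intro cSup_upper) (auto intro: bdd_aboveI[of _ 1])
    qed
    also have "\<dots> = z * real (card P)" by (simp add: mult.commute)
    finally show "?v \<le> z" using cP by (simp only: mult_le_cancel_right_pos of_nat_0_less_iff)
  qed

  moreover have "lower_value n d k \<le> ?v"
    using lower_value_le_layouts(1)[OF _ _ n0 ne] assms(1)
    by (intro LIMSEQ_le_const[OF layouts_bound_tendsto] exI[of _ d]) auto

  moreover have "upper_value n d k \<le> ?v"
    using upper_value_le_layouts[OF _ _ n0 ne] assms(1)
    by (intro LIMSEQ_le_const[OF layouts_bound_tendsto] exI[of _ d]) auto

  ultimately show "lower_value n d k = ?v \<and> upper_value n d k = ?v" by linarith
qed

end
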